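(* Let $m\ge 0$ and $n=m+3$. For every $(\boldsymbol x,\boldsymbol y)$-weighted triangulation $\Delta$ of the labeled convex $n$-gon $P_n$ there is a unique normalized positive Laurent decorated frieze $\mathcal F_\Delta=(W_{i,j})$ of width $m$ such that $W_{i,j}=\operatorname{wt}([v_i,v_j])$ whenever $1\le i<j\le n$ and $[v_i,v_j]$ is a boundary edge of $P_n$ or a diagonal of $\Delta$. The map $$\Delta\longmapsto \mathcal F_\Delta$$ is a bijection from the set of $(\boldsymbol x,\boldsymbol y)$-weighted triangulations of $P_n$ onto the set of normalized positive Laurent decorated friezes of width $m$. Moreover, the quiddity entries $a_i=W_{i,i+2}$ of $\mathcal F_\Delta$ are given by $a_i=Q_\Delta(v_{i+1})$ for all $i$, where for a vertex $v$ $$Q_\Delta(v)=\frac{\displaystyle\sum_{T\in\Delta,\ v\in T}\operatorname{wt}(\operatorname{opp}_v(T))\prod_{e\in E_v\setminus E_v(T)}\operatorname{wt}(e)}{\displaystyle\prod_{d\in D_v}\operatorname{wt}(d)} .$$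
   Context: Fix an integer $m\ge 0$ and put $n=m+3$. Let $\boldsymbol x=(x_1,\dots,x_m)$, $\boldsymbol y=(y_1,\dots,y_n)$ be algebraically independent variables, extend $y_{i+n}=y_i$ for $i\in\mathbb Z$, and put $\mathscr R_m=\mathbb Z[x_1^{\pm1},\dots,x_m^{\pm1},y_1^{\pm1},\dots,y_n^{\pm1}]$. A closed decorated frieze of width $m$ is a family $\mathcal F=(W_{i,j})$ of elements of $\mathscr R_m$, indexed by $i,j\in\mathbb Z$ with $0\le j-i\le n$, such that: (D1) $W_{i,i}=0$ and $W_{i,i+n}=0$ for all $i$; (D2) $W_{i,i+1}=y_i$ and $W_{i,i+n-1}=y_{i-1}$ for all $i$; (D3) every interior entry, i.e. every $W_{i,j}$ with $2\le j-i\le n-2$, is nonzero; (D4) for all $i,j$ with $1\le j-i\le n-1$, $W_{i,j}W_{i+1,j+1}-W_{i+1,j}W_{i,j+1}=y_iy_j$. No periodicity of the entries is assumed. It is a positive Laurent decorated frieze if every nonzero entry is a Laurent polynomial with nonnegative integer coefficients in the variables $x_1,\dots,x_m,y_1,\dots,y_n$. It is normalized (with respect to $\boldsymbol x$) if (N1) every interior entry that is a Laurent monomial (a product of integer powers of the variables) is one of $x_1,\dots,x_m$, and (N2) every $x_k$ occurs as an interior entry. $P_n$ is a convex $n$-gon with cyclically labeled vertices $v_1,\dots,v_n$ ($v_{i+n}=v_i$). An $(\boldsymbol x,\boldsymbol y)$-weighted triangulation $\Delta$ of $P_n$ is a triangulation of $P_n$ by pairwise non-crossing diagonals together with weights $\operatorname{wt}$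 on its edges: the boundary edge $[v_i,v_{i+1}]$ has weight $y_i$, and the $m=n-3$ internal diagonals are labeled bijectively by $x_1,\dots,x_m$. For a vertex $v$: $E_v$ is the set of all triangulation edges (boundary edges and diagonals) incident to $v$; $D_v\subset E_v$ is the set of internal diagonals incident to $v$; for a triangle $T$ of $\Delta$ containing $v$, $E_v(T)$ is the set of the two sides of $T$ incident to $v$ and $\operatorname{opp}_v(T)$ is the side of $T$ opposite $v$. Empty products equal $1$. *)

theory Defs
  imports Main "HOL-Library.Poly_Mapping" "HOL-Library.FuncSet"
begin

text \<open>
  Laurent polynomials with integer coefficients are finitely supported maps from exponent
  vectors (finitely supported maps from variables to \<open>int\<close>) to \<open>int\<close>; multiplication is the
  convolution product of \<open>Poly_Mapping\<close>. Throughout, \<open>n = m + 3\<close>.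
\<close>

datatype lvar = X nat | Y int

type_synonym laurent = "(lvar \<Rightarrow>\<^sub>0 int) \<Rightarrow>\<^sub>0 int"

abbreviation gon :: "nat \<Rightarrow> int" where
  "gon m \<equiv> int m + 3"

text \<open>The representative in \<open>{1..n}\<close> of the residue class of \<open>i\<close> modulo \<open>n\<close>; it serves both as the
  vertex \<open>v\<^sub>i\<close> and as the index of \<open>y\<^sub>i\<close>.\<close>

definition cyc :: "nat \<Rightarrow> int \<Rightarrow> int" where
  "cyc m i = (i - 1) mod gon m + 1"

definition laurent_var :: "lvar \<Rightarrow> laurent" where
  "laurent_var v = Poly_Mapping.single (Poly_Mapping.single v 1) 1"

definition xvar :: "nat \<Rightarrow> laurent" where
  "xvar k = laurent_var (X k)"

definition yvar :: "nat \<Rightarrow> int \<Rightarrow> laurent" where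
  "yvar m i = laurent_var (Y (cyc m i))"

definition laurent_ring :: "nat \<Rightarrow> laurent set" where
  "laurent_ring m =
     {p. \<forall>a \<in> Poly_Mapping.keys p. Poly_Mapping.keys a \<subseteq> X ` {1..m} \<union> Y ` {1..gon m}}"

definition laurent_monomial :: "laurent \<Rightarrow> bool" where
  "laurent_monomial p \<longleftrightarrow> (\<exists>a. p = Poly_Mapping.single a 1)"

definition nonneg_coeffs :: "laurent \<Rightarrow> bool" where
  "nonneg_coeffs p \<longleftrightarrow> (\<forall>a. 0 \<le> Poly_Mapping.lookup p a)"

definition strip :: "nat \<Rightarrow> (int \<times> int) set" where
  "strip m = {(i, j). 0 \<le> j - i \<and> j - i \<le> gon m}"

definition interior_indices :: "nat \<Rightarrow> (int \<times> int) set" where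
  "interior_indices m = {(i, j). 2 \<le> j - i \<and> j - i \<le> gon m - 2}"

text \<open>A family on the strip is an extensional function, so that equality of friezes is equality
  of families.\<close>

definition decorated_frieze :: "nat \<Rightarrow> (int \<times> int \<Rightarrow> laurent) \<Rightarrow> bool" where
  "decorated_frieze m W \<longleftrightarrow>
     W \<in> strip m \<rightarrow>\<^sub>E laurent_ring m \<and>
     (\<forall>i. W (i, i) = 0 \<and> W (i, i + gon m) = 0) \<and>
     (\<forall>i. W (i, i + 1) = yvar m i \<and> W (i, i + gon m - 1) = yvar m (i - 1)) \<and>
     (\<forall>(i, j) \<in> interior_indices m. W (i, j) \<noteq> 0) \<and>
     (\<forall>i j. 1 \<le> j - i \<and> j - i \<le> gon m - 1 \<longrightarrow>
        W (i, j) * W (i + 1, j + 1) - W (i + 1, j) * W (i, j + 1) = yvar m i * yvar m j)"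

definition positive_frieze :: "nat \<Rightarrow> (int \<times> int \<Rightarrow> laurent) \<Rightarrow> bool" where
  "positive_frieze m W \<longleftrightarrow>
     decorated_frieze m W \<and> (\<forall>p \<in> strip m. W p \<noteq> 0 \<longrightarrow> nonneg_coeffs (W p))"

definition normalized :: "nat \<Rightarrow> (int \<times> int \<Rightarrow> laurent) \<Rightarrow> bool" where
  "normalized m W \<longleftrightarrow>
     (\<forall>p \<in> interior_indices m. laurent_monomial (W p) \<longrightarrow> W p \<in> xvar ` {1..m}) \<and>
     (\<forall>k \<in> {1..m}. \<exists>p \<in> interior_indices m. W p = xvar k)"

definition normalized_positive_friezes :: "nat \<Rightarrow> (int \<times> int \<Rightarrow> laurent) set" where
  "normalized_positive_friezes m = {W. positive_frieze m W \<and> normalized m W}"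

text \<open>The convex polygon is treated combinatorially: an edge is the two-element set of its
  endpoints, and two segments cross in the interior of the polygon iff their endpoints strictly
  interlace in the cyclic order.\<close>

definition seg :: "nat \<Rightarrow> int \<Rightarrow> int \<Rightarrow> int set" where
  "seg m i j = {cyc m i, cyc m j}"

definition boundary_edges :: "nat \<Rightarrow> int set set" where
  "boundary_edges m = range (\<lambda>i. seg m i (i + 1))"

definition polygon_diagonals :: "nat \<Rightarrow> int set set" where
  "polygon_diagonals m = {e. e \<subseteq> {1..gon m} \<and> card e = 2} - boundary_edges m"

definition crossing :: "int set \<Rightarrow> int set \<Rightarrow> bool" where
  "crossing e f \<longleftrightarrow>
     (\<exists>a b c d. a < b \<and> b < c \<and> c < d \<and>
        (e = {a, c} \<and> f = {b, d} \<or> e = {b, d} \<and> f = {a, c}))"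

definition triangulation :: "nat \<Rightarrow> int set set \<Rightarrow> bool" where
  "triangulation m D \<longleftrightarrow>
     D \<subseteq> polygon_diagonals m \<and>
     (\<forall>e \<in> D. \<forall>f \<in> D. \<not> crossing e f) \<and>
     (\<forall>e \<in> polygon_diagonals m - D. \<exists>f \<in> D. crossing e f)"

text \<open>A weighted triangulation is the pair of its set of internal diagonals and its weight
  function, the latter extensional on the set of all edges.\<close>

type_synonym wtriang = "int set set \<times> (int set \<Rightarrow> laurent)"

definition edges :: "nat \<Rightarrow> wtriang \<Rightarrow> int set set" where
  "edges m \<Delta> = boundary_edges m \<union> fst \<Delta>"

abbreviation wt :: "wtriang \<Rightarrow> int set \<Rightarrow> laurent" where
  "wt \<Delta> \<equiv> snd \<Delta>"

definition weighted_triangulations :: "nat \<Rightarrow> wtriang set" where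
  "weighted_triangulations m =
     {\<Delta>. triangulation m (fst \<Delta>) \<and>
          wt \<Delta> \<in> extensional (edges m \<Delta>) \<and>
          (\<forall>i. wt \<Delta> (seg m i (i + 1)) = yvar m i) \<and>
          bij_betw (wt \<Delta>) (fst \<Delta>) (xvar ` {1..m})}"

text \<open>Since all vertices lie on the convex polygon, the triangles of a triangulation are exactly
  the triples of vertices that are pairwise joined by edges.\<close>

definition triangles :: "nat \<Rightarrow> wtriang \<Rightarrow> int set set" where
  "triangles m \<Delta> =
     {T. T \<subseteq> {1..gon m} \<and> card T = 3 \<and> (\<forall>e. e \<subseteq> T \<and> card e = 2 \<longrightarrow> e \<in> edges m \<Delta>)}"

definition edges_at :: "nat \<Rightarrow> wtriang \<Rightarrow> int \<Rightarrow> int set set" where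
  "edges_at m \<Delta> v = {e \<in> edges m \<Delta>. v \<in> e}"

definition diagonals_at :: "wtriang \<Rightarrow> int \<Rightarrow> int set set" where
  "diagonals_at \<Delta> v = {d \<in> fst \<Delta>. v \<in> d}"

definition triangle_edges_at :: "int \<Rightarrow> int set \<Rightarrow> int set set" where
  "triangle_edges_at v T = {e. e \<subseteq> T \<and> card e = 2 \<and> v \<in> e}"

definition opp :: "int \<Rightarrow> int set \<Rightarrow> int set" where
  "opp v T = T - {v}"

text \<open>The inverse of a unit. It is only applied to products of variables, whose inverses exist and
  lie in \<open>laurent_ring m\<close>.\<close>

definition unit_inverse :: "laurent \<Rightarrow> laurent" where
  "unit_inverse p = (THE q. p * q = 1)"

definition Q_value :: "nat \<Rightarrow> wtriang \<Rightarrow> int \<Rightarrow> laurent" where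
  "Q_value m \<Delta> v =
     (\<Sum>T \<in> {T \<in> triangles m \<Delta>. v \<in> T}.
        wt \<Delta> (opp v T) * (\<Prod>e \<in> edges_at m \<Delta> v - triangle_edges_at v T. wt \<Delta> e))
     * unit_inverse (\<Prod>d \<in> diagonals_at \<Delta> v. wt \<Delta> d)"

definition compatible :: "nat \<Rightarrow> wtriang \<Rightarrow> (int \<times> int \<Rightarrow> laurent) \<Rightarrow> bool" where
  "compatible m \<Delta> W \<longleftrightarrow>
     (\<forall>i j. 1 \<le> i \<and> i < j \<and> j \<le> gon m \<and> seg m i j \<in> edges m \<Delta> \<longrightarrow>
        W (i, j) = wt \<Delta> (seg m i j))"

definition frieze_of :: "nat \<Rightarrow> wtriang \<Rightarrow> (int \<times> int \<Rightarrow> laurent)" where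
  "frieze_of m \<Delta> = (THE W. W \<in> normalized_positive_friezes m \<and> compatible m \<Delta> W)"

end

theory Submission
  imports Defs
begin

text \<open>
  For a positive frieze the diamond rule forces linear recurrences along rows and columns, hence the
  glide symmetry \<open>W (i, j) = W (j, i + n)\<close> and the Ptolemy relation for all four-tuples of vertices.
  Every triangulation has an ear away from the first and last vertex; cutting off ears, the Ptolemy
  relation shows that the entries on a triangulation determine the frieze, and yields the formula for
  \<open>Q_value\<close> by adding the triangles at a vertex one by one. Conversely, the frieze of a triangulation
  consists of the determinants of vectors attached to the vertices: the vector at the tip of an ear is a
  combination of the two neighbouring ones whose coefficients are monomials, so Laurentness and positivity
  are visible. Finally, by Ptolemy, the product of entries on crossing diagonals is a sum of two nonzero
  positive Laurent polynomials, so monomial entries never cross; this recovers the triangulation.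
\<close>

section \<open>Triangulations and ears\<close>

text \<open>The frieze axioms are quadratic, carry no periodicity, and live in a ring without
  division. Divisions in the classical arguments therefore become cancellations of nonzero factors
  in an integral domain, and the quiddity formula is proved with its denominator multiplied out.
  Once the glide symmetry is known, a frieze is a function on unordered pairs from
  \<open>{1..n}\<close>. Rotating a quadruple of vertices does not change its Ptolemy relation, so
  the cyclic geometry can be expressed in the linear order of the integers. Keeping the ear away
  from the two extreme vertices serves the same purpose: its neighbours satisfy
  \<open>a < w < b\<close> with no other vertex between them. For existence this is decisive.
  Determinants are antisymmetric, and in this position every determinant with the new vector is a
  combination of old determinants taken in increasing order, so no minus sign enters.\<close>

lemma crossing_pairs:
  assumes "a < c" "b < d"
  shows "crossing {a, c} {b, d} \<longleftrightarrow> a < b \<and> b < c \<and> c < d \<or> b < a \<and> a < d \<and> d < c"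
  using assms unfolding crossing_def by (auto simp: doubleton_eq_iff)

lemma crossing_sym: "crossing e f \<Longrightarrow> crossing f e"
  unfolding crossing_def by blast

definition pairs :: "int set \<Rightarrow> int set set" where
  "pairs V = {e. e \<subseteq> V \<and> card e = 2}"

lemma pairsE:
  assumes "e \<in> pairs V"
  obtains a b where "e = {a, b}" "a < b" "a \<in> V" "b \<in> V"
proof -
  obtain a b where "e = {a, b}" "a \<noteq> b"
    using assms unfolding pairs_def by (auto simp: card_2_iff)
  moreover from this have "a \<in> V" "b \<in> V"
    using assms unfolding pairs_def by auto
  ultimately show thesis
    using that[of a b] that[of b a] by (cases "a < b") (simp_all add: insert_commute)
qed

lemma pair_in_pairs [simp]: "a \<noteq> b \<Longrightarrow> {a, b} \<in> pairs V \<longleftrightarrow> a \<in> V \<and> b \<in> V"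
  unfolding pairs_def by auto

lemma finite_pairs: "finite V \<Longrightarrow> finite (pairs V)"
  unfolding pairs_def by simp

definition noncrossing :: "int set set \<Rightarrow> bool" where
  "noncrossing E \<longleftrightarrow> (\<forall>e \<in> E. \<forall>f \<in> E. \<not> crossing e f)"

text \<open>The set \<open>E\<close> includes the sides of the polygon with vertex set \<open>V\<close>.\<close>

definition full_triangulation :: "int set \<Rightarrow> int set set \<Rightarrow> bool" where
  "full_triangulation V E \<longleftrightarrow>
     E \<subseteq> pairs V \<and> noncrossing E \<and> (\<forall>e \<in> pairs V - E. \<exists>f \<in> E. crossing e f)"

text \<open>Serves the bound on the size of an arbitrary noncrossing set: only sets that are maximal
  under inclusion can be counted by ears.\<close>

lemma noncrossing_extends:
  assumes "finite V" "E \<subseteq> pairs V" "noncrossing E"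
  obtains E' where "E \<subseteq> E'" "full_triangulation V E'"
proof -
  let ?A = "{E'. E \<subseteq> E' \<and> E' \<subseteq> pairs V \<and> noncrossing E'}"
  have "finite ?A" "E \<in> ?A"
    using assms finite_pairs[OF assms(1)] by auto
  then obtain E' where E': "E' \<in> ?A" and max: "\<And>F. F \<in> ?A \<Longrightarrow> E' \<subseteq> F \<Longrightarrow> F = E'"
    by (metis (no_types, lifting) finite_has_maximal2)
  have "\<exists>f \<in> E'. crossing e f" if e: "e \<in> pairs V - E'" for e
  proof (rule ccontr)
    assume "\<not> ?thesis"
    moreover have "\<not> crossing e e"
      using e by (auto elim!: pairsE simp: crossing_pairs)
    ultimately have "insert e E' \<in> ?A"
      using E' e unfolding noncrossing_def by (auto dest: crossing_sym)
    then have "insert e E' = E'"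
      using max by blast
    with e show False by blast
  qed
  with E' that show thesis
    unfolding full_triangulation_def by blast
qed

text \<open>Maximality in contrapositive form. With endpoints in increasing order, crossing splits
  into two linear patterns; every edge below is produced by excluding both.\<close>

lemma full_triangulation_edgeI:
  assumes "full_triangulation V E" "a \<in> V" "b \<in> V" "a < b"
    and "\<And>c d. c < d \<Longrightarrow> {c, d} \<in> E \<Longrightarrow>
           \<not> (a < c \<and> c < b \<and> b < d) \<and> \<not> (c < a \<and> a < d \<and> d < b)"
  shows "{a, b} \<in> E"
proof (rule ccontr)
  assume "{a, b} \<notin> E"
  with assms have "{a, b} \<in> pairs V - E" by auto
  then obtain f where f: "f \<in> E" "crossing {a, b} f"
    using assms(1) unfolding full_triangulation_def by blast
  then have "f \<in> pairs V"
    using assms(1) unfolding full_triangulation_def by blast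
  then obtain c d where "f = {c, d}" "c < d"
    by (elim pairsE)
  with f assms(4,5) show False
    by (auto simp: crossing_pairs)
qed

lemma full_triangulation_not_crossing:
  assumes "full_triangulation V E" "{a, b} \<in> E" "{c, d} \<in> E" "a < b" "c < d"
  shows "\<not> (a < c \<and> c < b \<and> b < d)"
  using assms crossing_pairs[of a b c d]
  unfolding full_triangulation_def noncrossing_def by blast

text \<open>\<open>V\<close> and \<open>E\<close> describe the polygon after the tip
  \<open>w\<close> has been cut off; \<open>a\<close> and \<open>b\<close> are consecutive in
  \<open>V\<close>, so \<open>{a, b}\<close> is one of its sides.\<close>

definition ear :: "int set \<Rightarrow> int set set \<Rightarrow> int \<Rightarrow> int \<Rightarrow> int \<Rightarrow> bool" where
  "ear V E a w b \<longleftrightarrow>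
     a \<in> V \<and> b \<in> V \<and> w \<notin> V \<and> a < w \<and> w < b \<and> (\<forall>u \<in> V. u \<le> a \<or> b \<le> u) \<and> {a, b} \<in> E"

text \<open>No vertex lies outside the span of this closing side, so nothing can cross it. It is the
  initial candidate in the search for a shortest edge.\<close>

lemma Min_Max_edge:
  assumes "full_triangulation V E" "finite V" "V \<noteq> {}" "Min V < Max V"
  shows "{Min V, Max V} \<in> E"
proof (rule full_triangulation_edgeI[OF assms(1)])
  show "Min V \<in> V" "Max V \<in> V"
    using assms(2,3) by auto
  fix c d assume "c < d" "{c, d} \<in> E"
  then have "c \<in> V" "d \<in> V"
    using assms(1) unfolding full_triangulation_def pairs_def by auto
  then have "Min V \<le> c" "d \<le> Max V"
    using assms(2) by auto
  then show "\<not> (Min V < c \<and> c < Max V \<and> Max V < d) \<and> \<not> (c < Min V \<and> Min V < d \<and> d < Max V)"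
    by auto
qed (use assms in auto)

text \<open>A shortest edge cutting off at least one vertex cuts off exactly one.\<close>

lemma ear_exists:
  assumes tri: "full_triangulation V E" and fin: "finite V" and card: "card V \<ge> 3"
  obtains a w b where "w \<in> V" "{a, w} \<in> E" "{w, b} \<in> E" "\<And>e. e \<in> E \<Longrightarrow> w \<in> e \<Longrightarrow> e = {a, w} \<or> e = {w, b}"
    "ear (V - {w}) (E - {{a, w}, {w, b}}) a w b"
    "full_triangulation (V - {w}) (E - {{a, w}, {w, b}})"
proof -
  have sub: "c \<in> V \<and> d \<in> V" if "{c, d} \<in> E" for c d
    using tri that unfolding full_triangulation_def pairs_def by auto
  have nc: "\<not> (a < c \<and> c < b \<and> b < d)" if "{a, b} \<in> E" "{c, d} \<in> E" for a b c d
    using full_triangulation_not_crossing[OF tri that] by auto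
  have ne: "V \<noteq> {}" using card by auto
  let ?P = "\<lambda>(a, b). {a, b} \<in> E \<and> (\<exists>c \<in> V. a < c \<and> c < b)"
  have "V - {Min V, Max V} \<noteq> {}"
  proof
    assume "V - {Min V, Max V} = {}"
    then have "card V \<le> card {Min V, Max V}"
      by (intro card_mono) auto
    also have "\<dots> \<le> 2"
      by (simp add: card_insert_if)
    finally show False using card by simp
  qed
  then obtain c where c: "c \<in> V" "c \<noteq> Min V" "c \<noteq> Max V" by blast
  then have "Min V < c" "c < Max V"
    using fin by (simp_all add: order.strict_iff_order)
  then have "?P (Min V, Max V)"
    using Min_Max_edge[OF tri fin ne] c(1) by auto
  then obtain ab where ab: "?P ab" and min: "\<And>p. ?P p \<Longrightarrow> nat (snd ab - fst ab) \<le> nat (snd p - fst p)"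
    using ex_has_least_nat[of ?P _ "\<lambda>p. nat (snd p - fst p)"] by blast
  define a where "a = fst ab"
  define b where "b = snd ab"
  have ab': "{a, b} \<in> E" and "\<exists>c \<in> V. a < c \<and> c < b"
    using ab unfolding a_def b_def by (auto simp: case_prod_beta)
  have short: "\<not> (\<exists>c \<in> V. a' < c \<and> c < b')" if "{a', b'} \<in> E" "a' < b'" "b' - a' < b - a" for a' b'
  proof
    assume "\<exists>c \<in> V. a' < c \<and> c < b'"
    then have "?P (a', b')"
      using that(1) by simp
    from min[OF this] have "nat (b - a) \<le> nat (b' - a')"
      by (simp add: a_def b_def)
    moreover have "nat (b' - a') < nat (b - a)"
      using that(2,3) by simp
    ultimately show False by simp
  qed
  define w where "w = Min {c \<in> V. a < c \<and> c < b}"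
  have "w \<in> {c \<in> V. a < c \<and> c < b}"
    unfolding w_def using fin \<open>\<exists>c \<in> V. a < c \<and> c < b\<close> by (intro Min_in) auto
  then have w: "w \<in> V" "a < w" "w < b" by auto
  have wmin: "w \<le> c" if "c \<in> V" "a < c" "c < b" for c
    unfolding w_def using fin that by (intro Min_le) auto
  have only: "c = w" if c: "c \<in> V" "a < c" "c < b" for c
  proof (rule ccontr)
    assume "c \<noteq> w"
    then have wc: "w < c" using wmin[OF c] by simp
    define d where "d = Min {c \<in> V. w < c}"
    have "d \<in> {c \<in> V. w < c}"
      unfolding d_def using fin c wc by (intro Min_in) auto
    moreover have "d \<le> c"
      unfolding d_def using fin c wc by (intro Min_le) auto
    ultimately have d: "d \<in> V" "w < d" "d < b" using c by auto
    have dmin: "d \<le> u" if "u \<in> V" "w < u" for u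
      unfolding d_def using fin that by (intro Min_le) auto
    \<comment> \<open>Here \<open>d\<close> is the vertex after \<open>w\<close>. An edge crossing
      \<open>{a, d}\<close> from inside starts at \<open>w\<close> and ends no later than
      \<open>b\<close>, so it is shorter than \<open>{a, b}\<close> and cuts off \<open>d\<close>;
      one from outside crosses \<open>{a, b}\<close>. Hence \<open>{a, d}\<close> is an edge, and
      being shorter and cutting off \<open>w\<close> it contradicts minimality.\<close>
    have "{a, d} \<in> E"
    proof (rule full_triangulation_edgeI[OF tri])
      fix p q assume pq: "p < q" "{p, q} \<in> E"
      note s = sub[OF pq(2)]
      have "\<not> (a < p \<and> p < d \<and> d < q)"
      proof
        assume *: "a < p \<and> p < d \<and> d < q"
        then have "p = w" using dmin[of p] wmin[of p] s d by force
        moreover have "q \<le> b" using nc[OF ab' pq(2)] * d by auto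
        ultimately show False using short[OF pq(2) pq(1)] * d w by auto
      qed
      moreover have "\<not> (p < a \<and> a < q \<and> q < d)"
        using nc[OF pq(2) ab'] d by auto
      ultimately show "\<not> (a < p \<and> p < d \<and> d < q) \<and> \<not> (p < a \<and> a < q \<and> q < d)" by blast
    qed (use sub[OF ab'] d w in auto)
    from short[OF this] d w show False by auto
  qed
  have gap: "c \<le> a \<or> c = w \<or> b \<le> c" if "c \<in> V" for c
    using only[OF that] by (meson not_less)
  have aw: "{a, w} \<in> E"
  proof (rule full_triangulation_edgeI[OF tri])
    fix p q assume pq: "p < q" "{p, q} \<in> E"
    then show "\<not> (a < p \<and> p < w \<and> w < q) \<and> \<not> (p < a \<and> a < q \<and> q < w)"
      using gap[of p] gap[of q] sub[OF pq(2)] w by auto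
  qed (use sub[OF ab'] w in auto)
  have wb: "{w, b} \<in> E"
  proof (rule full_triangulation_edgeI[OF tri])
    fix p q assume pq: "p < q" "{p, q} \<in> E"
    then show "\<not> (w < p \<and> p < b \<and> b < q) \<and> \<not> (p < w \<and> w < q \<and> q < b)"
      using gap[of p] gap[of q] sub[OF pq(2)] w by auto
  qed (use sub[OF ab'] w in auto)
  \<comment> \<open>Any other edge at \<open>w\<close> would leave the gap between \<open>a\<close>
    and \<open>b\<close> and so cross \<open>{a, b}\<close>.\<close>
  have at_w: "e = {a, w} \<or> e = {w, b}" if e: "e \<in> E" "w \<in> e" for e
  proof -
    have "e \<in> pairs V"
      using tri e unfolding full_triangulation_def by blast
    then obtain p q where pq: "e = {p, q}" "p < q" "p \<in> V" "q \<in> V"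
      by (elim pairsE)
    show ?thesis
    proof (cases "p = w")
      case True
      then have "q = b"
        using nc[OF ab', of p q] e(1) gap[OF pq(4)] pq(1,2) w by auto
      with True pq show ?thesis by auto
    next
      case False
      then have "q = w" using e pq by auto
      then have "p = a"
        using nc[OF _ ab', of p q] e(1) gap[OF pq(3)] pq(1,2) w by auto
      with \<open>q = w\<close> pq show ?thesis by auto
    qed
  qed
  let ?E = "E - {{a, w}, {w, b}}"
  have "full_triangulation (V - {w}) ?E"
    unfolding full_triangulation_def
  proof (intro conjI ballI)
    show "?E \<subseteq> pairs (V - {w})"
    proof
      fix e assume "e \<in> ?E"
      then have "e \<in> pairs V" "w \<notin> e"
        using tri at_w unfolding full_triangulation_def by blast+
      then show "e \<in> pairs (V - {w})" unfolding pairs_def by auto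
    qed
    show "noncrossing ?E"
      using tri unfolding full_triangulation_def noncrossing_def by auto
    fix e assume e: "e \<in> pairs (V - {w}) - ?E"
    then have "w \<notin> e" unfolding pairs_def by auto
    then have "e \<in> pairs V - E" using e unfolding pairs_def by auto
    then obtain f where f: "f \<in> E" "crossing e f"
      using tri unfolding full_triangulation_def by blast
    obtain p q where pq: "e = {p, q}" "p < q" "p \<in> V" "q \<in> V" "p \<noteq> w" "q \<noteq> w"
      using e by (auto elim!: pairsE)
    \<comment> \<open>Crossing one of the two removed edges requires an endpoint strictly between
      consecutive vertices.\<close>
    have "f \<noteq> {a, w}" "f \<noteq> {w, b}"
      using f(2) pq(2,5,6) w gap[OF pq(3)] gap[OF pq(4)] unfolding pq(1) by (auto simp: crossing_pairs)
    with f show "\<exists>f \<in> ?E. crossing e f" by blast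
  qed
  moreover have "ear (V - {w}) ?E a w b"
    unfolding ear_def using w ab' sub[OF ab'] gap by (auto simp: doubleton_eq_iff)
  ultimately show thesis
    using that w aw wb at_w by blast
qed

text \<open>Starting from a digon instead of a triangle makes the triangle itself an ear on an edge,
  so there is a single kind of inductive step and a trivial base.\<close>

lemma full_triangulation_induct [consumes 3, case_names base ear]:
  assumes "full_triangulation V E" "finite V" "card V \<ge> 2"
    and base: "\<And>a b. a < b \<Longrightarrow> P {a, b} {{a, b}}"
    and ear: "\<And>V E a w b. full_triangulation V E \<Longrightarrow> finite V \<Longrightarrow> card V \<ge> 2 \<Longrightarrow> ear V E a w b \<Longrightarrow>
      P V E \<Longrightarrow> P (insert w V) (insert {a, w} (insert {w, b} E))"
  shows "P V E"
  using assms(1-3)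
proof (induction "card V" arbitrary: V E rule: less_induct)
  case less
  show ?case
  proof (cases "card V = 2")
    case True
    then obtain a b where V: "V = {a, b}" "a < b"
      by (metis card_2_iff insert_commute linorder_neqE)
    have "E \<subseteq> pairs V"
      using less.prems(1) unfolding full_triangulation_def by blast
    moreover have "pairs V = {{a, b}}"
      using V by (auto elim!: pairsE)
    moreover have "{a, b} \<in> E"
      using Min_Max_edge[OF less.prems(1,2)] unfolding V(1) using V(2) by simp
    ultimately have "E = {{a, b}}" by blast
    with V base show ?thesis by simp
  next
    case False
    with less.prems have "card V \<ge> 3" by simp
    then obtain a w b where *: "w \<in> V" "{a, w} \<in> E" "{w, b} \<in> E"
      "ear (V - {w}) (E - {{a, w}, {w, b}}) a w b"
      "full_triangulation (V - {w}) (E - {{a, w}, {w, b}})"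
      using ear_exists[OF less.prems(1,2)] by metis
    have "P (V - {w}) (E - {{a, w}, {w, b}})"
      using less.prems * \<open>card V \<ge> 3\<close> by (intro less.hyps) auto
    from ear[OF *(5) _ _ *(4) this] less.prems * \<open>card V \<ge> 3\<close>
    have "P (insert w (V - {w})) (insert {a, w} (insert {w, b} (E - {{a, w}, {w, b}})))"
      by auto
    moreover have "insert w (V - {w}) = V" "insert {a, w} (insert {w, b} (E - {{a, w}, {w, b}})) = E"
      using * by auto
    ultimately show ?thesis by simp
  qed
qed

lemma edge_endpoints: "full_triangulation V E \<Longrightarrow> e \<in> E \<Longrightarrow> e \<subseteq> V"
  unfolding full_triangulation_def pairs_def by blast

lemma finite_full_triangulation:
  "full_triangulation V E \<Longrightarrow> finite V \<Longrightarrow> finite E"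
  unfolding full_triangulation_def by (meson finite_pairs finite_subset)

text \<open>Each ear contributes one vertex and two edges. The additive form avoids truncated
  subtraction.\<close>

lemma card_full_triangulation:
  assumes "full_triangulation V E" "finite V" "card V \<ge> 2"
  shows "card E + 3 = 2 * card V"
  using assms
proof (induction rule: full_triangulation_induct)
  case (base a b)
  then show ?case by simp
next
  case (ear V E a w b)
  have "w \<notin> V" "a < w" "w < b" using ear.hyps(4) unfolding ear_def by auto
  moreover have "{a, w} \<notin> E" "{w, b} \<notin> E"
    using edge_endpoints[OF ear.hyps(1)] \<open>w \<notin> V\<close> by blast+
  ultimately show ?case
    using ear finite_full_triangulation[OF ear.hyps(1,2)] by (simp add: doubleton_eq_iff)
qed

section \<open>Ptolemy relations on a triangulation\<close>

text \<open>Symmetry is built in by evaluating on sets; the singleton \<open>{a}\<close> is the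
  degenerate pair \<open>{a, a}\<close>, so the vanishing condition extends the relation to
  quadruples with coinciding vertices.\<close>

definition ptolemy :: "int set \<Rightarrow> (int set \<Rightarrow> 'a::comm_ring_1) \<Rightarrow> bool" where
  "ptolemy V g \<longleftrightarrow> (\<forall>a. g {a} = 0) \<and>
     (\<forall>a \<in> V. \<forall>b \<in> V. \<forall>c \<in> V. \<forall>d \<in> V. a < b \<and> b < c \<and> c < d \<longrightarrow>
        g {a, c} * g {b, d} = g {a, b} * g {c, d} + g {a, d} * g {b, c})"

lemma ptolemy_subset: "ptolemy V g \<Longrightarrow> U \<subseteq> V \<Longrightarrow> ptolemy U g"
  unfolding ptolemy_def by blast

text \<open>This is Ptolemy for the quadrilateral \<open>a\<close>, \<open>w\<close>,
  \<open>b\<close>, \<open>r\<close>, on whichever side of the gap \<open>r\<close> lies. It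
  expresses all values at the tip through values on \<open>V\<close> and the two new edges.\<close>

lemma ptolemy_ear:
  assumes "ptolemy (insert w V) g" "ear V E a w b" "r \<in> V"
  shows "g {a, b} * g {w, r} = g {a, w} * g {b, r} + g {w, b} * g {a, r}"
proof -
  have V: "a \<in> V" "b \<in> V" "a < w" "w < b" and r: "r \<le> a \<or> b \<le> r"
    using assms(2,3) unfolding ear_def by auto
  have z: "g {u} = 0" for u
    using assms(1) unfolding ptolemy_def by blast
  have P: "g {p, s} * g {q, t} = g {p, q} * g {s, t} + g {p, t} * g {q, s}"
    if "{p, q, s, t} \<subseteq> insert w V" "p < q" "q < s" "s < t" for p q s t
    using assms(1) that unfolding ptolemy_def by auto
  consider "r = a" | "r = b" | "r < a" | "b < r"
    using r by fastforce
  then show ?thesis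
  proof cases
    case 1
    then show ?thesis using z by (simp add: insert_commute mult.commute)
  next
    case 2
    then show ?thesis using z by (simp add: insert_commute mult.commute)
  next
    case 3
    then show ?thesis
      using P[of r a w b] V assms(3) by (simp add: insert_commute algebra_simps)
  next
    case 4
    then show ?thesis
      using P[of a w b r] V assms(3) by (simp add: insert_commute algebra_simps)
  qed
qed

text \<open>Along the ear induction, \<open>ptolemy_ear\<close> fixes each value at the tip up to
  the factor \<open>g {a, b}\<close>, which belongs to an edge and can be cancelled.\<close>

lemma ptolemy_unique:
  fixes g h :: "int set \<Rightarrow> 'a::idom"
  assumes "full_triangulation V E" "finite V" "card V \<ge> 2"
    and "ptolemy V g" "ptolemy V h"
    and "\<And>e. e \<in> E \<Longrightarrow> g e \<noteq> 0" "\<And>e. e \<in> E \<Longrightarrow> g e = h e"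
    and "a \<in> V" "b \<in> V"
  shows "g {a, b} = h {a, b}"
proof -
  have "ptolemy V g \<Longrightarrow> ptolemy V h \<Longrightarrow> \<forall>e \<in> E. g e \<noteq> 0 \<and> g e = h e \<Longrightarrow>
      \<forall>p \<in> V. \<forall>q \<in> V. g {p, q} = h {p, q}"
    using assms(1-3)
  proof (induction rule: full_triangulation_induct)
    case (base a b)
    then show ?case
      unfolding ptolemy_def by (simp add: insert_commute)
  next
    case (ear V E a w b)
    have V: "a \<in> V" "b \<in> V" "{a, b} \<in> E"
      using ear.hyps(4) unfolding ear_def by auto
    have IH: "g {p, q} = h {p, q}" if "p \<in> V" "q \<in> V" for p q
      using ear.IH ear.prems that by (meson insertI2 ptolemy_subset subset_insertI)
    have w: "g {w, r} = h {w, r}" if "r \<in> V" for r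
    proof -
      have "g {a, b} * g {w, r} = g {a, b} * h {w, r}"
        using ptolemy_ear[OF ear.prems(1) ear.hyps(4) that] ptolemy_ear[OF ear.prems(2) ear.hyps(4) that]
          IH V that ear.prems(3) by simp
      then show ?thesis
        using bspec[OF ear.prems(3), of "{a, b}"] V by auto
    qed
    moreover have "g {w} = h {w}"
      using ear.prems(1,2) unfolding ptolemy_def by simp
    ultimately show ?case
      using IH by (auto simp: insert_commute)
  qed
  with assms show ?thesis by blast
qed

section \<open>The triangles at a vertex\<close>

text \<open>Cyclic successor in the linear order; the second disjunct is the wrap-around from the
  largest to the smallest vertex. In a digon successor and predecessor coincide.\<close>

definition next_vertex :: "int set \<Rightarrow> int \<Rightarrow> int \<Rightarrow> bool" where
  "next_vertex V p q \<longleftrightarrow> p \<in> V \<and> q \<in> V \<and>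
     (p < q \<and> (\<forall>u \<in> V. u \<le> p \<or> q \<le> u) \<or> q < p \<and> (\<forall>u \<in> V. q \<le> u \<and> u \<le> p))"

definition neighbours :: "int set set \<Rightarrow> int \<Rightarrow> int set" where
  "neighbours E v = {u. u \<noteq> v \<and> {v, u} \<in> E}"

text \<open>The numerator of \<open>Q_value\<close>: a triangle at \<open>v\<close> is represented
  by its opposite side, an edge joining two neighbours of \<open>v\<close>.\<close>

definition star_sum :: "int set set \<Rightarrow> (int set \<Rightarrow> 'a::comm_ring_1) \<Rightarrow> int \<Rightarrow> 'a" where
  "star_sum E g v = (\<Sum>e \<in> {e \<in> E. e \<subseteq> neighbours E v}. g e * (\<Prod>u \<in> neighbours E v - e. g {v, u}))"

lemma neighbours_subset: "full_triangulation V E \<Longrightarrow> neighbours E v \<subseteq> V"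
  unfolding neighbours_def by (auto dest: edge_endpoints)

text \<open>Gluing an ear \<open>w\<close> onto the side \<open>{v, c}\<close> changes the link of \<open>v\<close> by one triangle.\<close>

lemma star_sum_glue:
  assumes tri: "full_triangulation V E" and fin: "finite V"
    and w: "w \<notin> V" and c: "v \<in> V" "c \<in> V" "v \<noteq> c" "{v, c} \<in> E" and r: "r \<in> neighbours E v"
    and zero: "\<And>u. g {u} = 0"
    and ptol: "g {v, c} * g {w, r} = g {v, w} * g {c, r} + g {w, c} * g {v, r}"
    and IH: "g {c, r} * (\<Prod>u \<in> neighbours E v - {c, r}. g {v, u}) = star_sum E g v"
  defines "F \<equiv> insert {v, w} (insert {w, c} E)"
  shows "g {w, r} * (\<Prod>u \<in> neighbours F v - {w, r}. g {v, u}) = star_sum F g v"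
proof -
  let ?N = "neighbours E v"
  have finN: "finite ?N"
    using neighbours_subset[OF tri] fin by (metis finite_subset)
  have wN: "w \<notin> ?N" and cN: "c \<in> ?N"
    using neighbours_subset[OF tri, of v] w c unfolding neighbours_def by auto
  have vw: "v \<noteq> w" "c \<noteq> w" using c w by auto
  have wE: "w \<notin> e" if "e \<in> E" for e
    using edge_endpoints[OF tri that] w by blast
  have N: "neighbours F v = insert w ?N"
    unfolding neighbours_def F_def using vw c(3) by (auto simp: doubleton_eq_iff)
  \<comment> \<open>Gluing adds exactly one triangle at \<open>v\<close>, the one with opposite side
    \<open>{w, c}\<close>.\<close>
  have S: "{e \<in> F. e \<subseteq> insert w ?N} = insert {w, c} {e \<in> E. e \<subseteq> ?N}"
  proof -
    have "v \<notin> insert w ?N" using vw unfolding neighbours_def by auto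
    then have "\<not> {v, w} \<subseteq> insert w ?N" by blast
    moreover have "{w, c} \<subseteq> insert w ?N" using cN by blast
    moreover have "e \<subseteq> insert w ?N \<longleftrightarrow> e \<subseteq> ?N" if "e \<in> E" for e
      using wE[OF that] by blast
    ultimately show ?thesis
      unfolding F_def by blast
  qed
  have "{w, c} \<notin> {e \<in> E. e \<subseteq> ?N}" "finite {e \<in> E. e \<subseteq> ?N}"
    using wE finite_full_triangulation[OF tri fin] by auto
  then have "star_sum F g v = g {w, c} * (\<Prod>u \<in> insert w ?N - {w, c}. g {v, u})
      + (\<Sum>e \<in> {e \<in> E. e \<subseteq> ?N}. g e * (\<Prod>u \<in> insert w ?N - e. g {v, u}))"
    unfolding star_sum_def N S by (subst sum.insert) auto
  \<comment> \<open>The new edge \<open>{v, w}\<close> belongs to none of the old triangles, so each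
    old summand acquires the factor \<open>g {v, w}\<close>.\<close>
  also have "(\<Sum>e \<in> {e \<in> E. e \<subseteq> ?N}. g e * (\<Prod>u \<in> insert w ?N - e. g {v, u})) = g {v, w} * star_sum E g v"
    unfolding star_sum_def sum_distrib_left
  proof (rule sum.cong)
    fix e assume "e \<in> {e \<in> E. e \<subseteq> ?N}"
    then have "insert w ?N - e = insert w (?N - e)"
      using wE by auto
    then show "g e * (\<Prod>u \<in> insert w ?N - e. g {v, u}) = g {v, w} * (g e * (\<Prod>u \<in> ?N - e. g {v, u}))"
      using finN wN by (simp add: mult.left_commute)
  qed simp
  also have "insert w ?N - {w, c} = ?N - {c}" using wN by blast
  finally have sum: "star_sum F g v = g {w, c} * (\<Prod>u \<in> ?N - {c}. g {v, u})
      + g {v, w} * (g {c, r} * (\<Prod>u \<in> ?N - {c, r}. g {v, u}))"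
    unfolding IH .
  have D: "insert w ?N - {w, r} = ?N - {r}" using wN by blast
  show ?thesis
  \<comment> \<open>In the applications \<open>r = c\<close> means that the old polygon is a digon;
    the old contribution then vanishes because \<open>g {c} = 0\<close>.\<close>
  proof (cases "r = c")
    case True
    then show ?thesis unfolding sum N D using zero by (simp add: insert_commute)
  next
    case False
    let ?R = "\<Prod>u \<in> ?N - {c, r}. g {v, u}"
    have "?N - {r} = insert c (?N - {c, r})" "?N - {c} = insert r (?N - {c, r})"
      using cN r False by blast+
    then have 1: "(\<Prod>u \<in> ?N - {r}. g {v, u}) = g {v, c} * ?R"
      and 2: "(\<Prod>u \<in> ?N - {c}. g {v, u}) = g {v, r} * ?R"
      using finN by (metis (no_types, lifting) Diff_iff finite_Diff insertI1 insertI2 prod.insert)+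
    have "g {w, r} * (\<Prod>u \<in> ?N - {r}. g {v, u}) = (g {v, c} * g {w, r}) * ?R"
      unfolding 1 by (simp only: ac_simps)
    also have "\<dots> = g {w, c} * (\<Prod>u \<in> ?N - {c}. g {v, u}) + g {v, w} * (g {c, r} * ?R)"
      unfolding ptol 2 by (simp only: distrib_left ac_simps)
    finally show ?thesis unfolding sum N D .
  qed
qed

lemma next_vertex_edge:
  assumes "full_triangulation V E" "next_vertex V p q"
  shows "{p, q} \<in> E"
proof -
  have V: "c \<in> V \<and> d \<in> V" if "{c, d} \<in> E" for c d
    using edge_endpoints[OF assms(1) that] by auto
  have pq: "p \<in> V" "q \<in> V" using assms(2) unfolding next_vertex_def by auto
  consider "p < q" "\<forall>u \<in> V. u \<le> p \<or> q \<le> u" | "q < p" "\<forall>u \<in> V. q \<le> u \<and> u \<le> p"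
    using assms(2) unfolding next_vertex_def by auto
  then show ?thesis
  proof cases
    case 1
    then show ?thesis
      using full_triangulation_edgeI[OF assms(1) pq] V by (meson not_less)
  next
    case 2
    then have "{q, p} \<in> E"
      using full_triangulation_edgeI[OF assms(1) pq(2,1)] V by (meson not_less)
    then show ?thesis by (simp add: insert_commute)
  qed
qed

text \<open>The quiddity formula without division: dropping the two polygon sides from the edges at
  \<open>v\<close> leaves the diagonals, whose product is the denominator. An ear changes the
  formula only if \<open>v\<close> is its tip or an end of its base.\<close>

lemma star_formula:
  fixes g :: "int set \<Rightarrow> 'a::comm_ring_1"
  assumes "full_triangulation V E" "finite V" "card V \<ge> 2"
    and "ptolemy V g" "next_vertex V p v" "next_vertex V v q"
  shows "g {p, q} * (\<Prod>u \<in> neighbours E v - {p, q}. g {v, u}) = star_sum E g v"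
  using assms
proof (induction arbitrary: p q rule: full_triangulation_induct)
  case (base a b)
  \<comment> \<open>In a digon both neighbours agree and there is no triangle, so both sides are
    zero.\<close>
  then have "p = q" "p \<noteq> v" "{a, b} = {p, v}"
    unfolding next_vertex_def by auto
  have N: "neighbours {{p, v}} v = {p}"
    unfolding neighbours_def using \<open>p \<noteq> v\<close> by (auto simp: doubleton_eq_iff)
  moreover have "{e \<in> {{p, v}}. e \<subseteq> {p}} = {}"
    using \<open>p \<noteq> v\<close> by auto
  ultimately have "star_sum {{p, v}} g v = 0"
    unfolding star_sum_def N by (simp only: sum.empty)
  then show ?case
    unfolding \<open>{a, b} = {p, v}\<close> using \<open>p = q\<close> base.prems(1) by (simp add: ptolemy_def)
next
  case (ear V E a w b)
  let ?F = "insert {a, w} (insert {w, b} E)"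
  have V: "a \<in> V" "b \<in> V" "{a, b} \<in> E" "w \<notin> V" "a < w" "w < b" and gap: "\<And>u. u \<in> V \<Longrightarrow> u \<le> a \<or> b \<le> u"
    using ear.hyps(4) unfolding ear_def by auto
  have wE: "w \<notin> e" if "e \<in> E" for e
    using edge_endpoints[OF ear.hyps(1) that] V by blast
  have g0: "g {u} = 0" for u
    using ear.prems(1) unfolding ptolemy_def by blast
  have pt: "ptolemy V g"
    using ear.prems(1) by (rule ptolemy_subset) blast
  note P = ptolemy_ear[OF ear.prems(1) ear.hyps(4)]
  have nxt_w: "x = b" if "next_vertex (insert w V) w x" for x
  proof -
    have "w < x \<and> (b \<le> w \<or> x \<le> b) \<or> x < w \<and> b \<le> w" "x \<in> V \<or> x = w"
      using that V(2) unfolding next_vertex_def by blast+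
    then show ?thesis using gap[of x] V(5,6) by auto
  qed
  have prv_w: "x = a" if "next_vertex (insert w V) x w" for x
  proof -
    have "x < w \<and> (a \<le> x \<or> w \<le> a) \<or> w < x \<and> w \<le> a" "x \<in> V \<or> x = w"
      using that V(1) unfolding next_vertex_def by blast+
    then show ?thesis using gap[of x] V(5,6) by auto
  qed
  have "u \<le> a \<or> w \<le> u" "u \<le> w \<or> b \<le> u" if "u \<in> insert w V" for u
    using that gap[of u] V(5,6) by auto
  then have nxt_a: "next_vertex (insert w V) a w" and prv_b: "next_vertex (insert w V) w b"
    using V(1,2,5,6) unfolding next_vertex_def by blast+
  have nxt_ab: "next_vertex V a b"
    using V gap unfolding next_vertex_def by auto
  have uniq: "y = z" if "next_vertex U x y" "next_vertex U x z" for U x y z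
  proof -
    have "x < y \<and> (z \<le> x \<or> y \<le> z) \<or> y < x \<and> y \<le> z \<and> z \<le> x"
      "x < z \<and> (y \<le> x \<or> z \<le> y) \<or> z < x \<and> z \<le> y \<and> y \<le> x"
      using that unfolding next_vertex_def by blast+
    then show ?thesis by auto
  qed
  have uniq': "y = z" if "next_vertex U y x" "next_vertex U z x" for U x y z
  proof -
    have "y < x \<and> (z \<le> y \<or> x \<le> z) \<or> x < y \<and> x \<le> z \<and> z \<le> y"
      "z < x \<and> (y \<le> z \<or> x \<le> y) \<or> x < z \<and> x \<le> y \<and> y \<le> z"
      using that unfolding next_vertex_def by blast+
    then show ?thesis by auto
  qed
  have restrict: "next_vertex V x y" if "next_vertex (insert w V) x y" "x \<noteq> w" "y \<noteq> w" for x y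
    using that unfolding next_vertex_def by blast
  consider "v = w" | "v = a" | "v = b" | "v \<noteq> w" "v \<noteq> a" "v \<noteq> b" by blast
  then show ?case
  proof cases
    case 1
    have N: "neighbours ?F w = {a, b}"
      unfolding neighbours_def using V wE by (auto simp: doubleton_eq_iff)
    have S: "{e \<in> ?F. e \<subseteq> {a, b}} = {{a, b}}"
    proof -
      have "e = {a, b}" if "e \<in> E" "e \<subseteq> {a, b}" for e
      proof -
        have "card e = 2"
          using ear.hyps(1) that(1) unfolding full_triangulation_def pairs_def by auto
        then show ?thesis
          using that(2) V by (intro card_subset_eq) auto
      qed
      then show ?thesis using V(3-6) by auto
    qed
    have "p = a" "q = b"
      using nxt_w prv_w ear.prems(2,3) 1 by blast+
    then show ?thesis
      unfolding star_sum_def 1 N S by simp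
  next
    case 2
    \<comment> \<open>The tip replaces \<open>b\<close> as successor of \<open>a\<close>, while the
      predecessor \<open>p\<close> stays: \<open>star_sum_glue\<close> applies with
      \<open>c = b\<close> and \<open>r = p\<close>. The case \<open>v = b\<close> is its mirror
      image.\<close>
    have q: "q = w" using uniq[OF ear.prems(3)] nxt_a 2 by auto
    have "p \<noteq> w" using nxt_w[of v] ear.prems(2) 2 V(5,6) by auto
    then have pV: "next_vertex V p a"
      using restrict[OF ear.prems(2)] 2 V(5) by auto
    then have "p \<in> neighbours E a"
      using next_vertex_edge[OF ear.hyps(1) pV] unfolding neighbours_def next_vertex_def
      by (auto simp: insert_commute)
    moreover have "p \<in> V" using pV unfolding next_vertex_def by auto
    ultimately have "g {w, p} * (\<Prod>u \<in> neighbours ?F a - {w, p}. g {a, u}) = star_sum ?F g a"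
      using V g0 P[of p] ear.IH[OF pt, of p b] pV nxt_ab 2
      by (intro star_sum_glue[OF ear.hyps(1,2)]) (auto simp: insert_commute)
    then show ?thesis using 2 q by (simp add: insert_commute)
  next
    case 3
    have p: "p = w" using uniq'[OF ear.prems(2)] prv_b 3 by auto
    have "q \<noteq> w" using prv_w[of v] ear.prems(3) 3 V(5,6) by auto
    then have qV: "next_vertex V b q"
      using restrict[OF ear.prems(3)] 3 V(6) by auto
    then have "q \<in> neighbours E b"
      using next_vertex_edge[OF ear.hyps(1) qV] unfolding neighbours_def next_vertex_def by (auto simp: insert_commute)
    moreover have "q \<in> V" using qV unfolding next_vertex_def by auto
    ultimately have "g {w, q} * (\<Prod>u \<in> neighbours (insert {b, w} (insert {w, a} E)) b - {w, q}. g {b, u})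
        = star_sum (insert {b, w} (insert {w, a} E)) g b"
      using V g0 P[of q] ear.IH[OF pt, of a q] qV nxt_ab 3
      by (intro star_sum_glue[OF ear.hyps(1,2)]) (auto simp: insert_commute add.commute)
    then show ?thesis using 3 p by (simp add: insert_commute)
  next
    case 4
    have "p \<noteq> w" "q \<noteq> w"
      using nxt_w ear.prems 4 prv_w by blast+
    then have "g {p, q} * (\<Prod>u \<in> neighbours E v - {p, q}. g {v, u}) = star_sum E g v"
      using ear.IH[OF pt] restrict ear.prems 4 by blast
    moreover have N: "neighbours ?F v = neighbours E v"
      unfolding neighbours_def using 4 by (auto simp: doubleton_eq_iff)
    moreover have "w \<notin> neighbours E v"
      using neighbours_subset[OF ear.hyps(1)] V by blast
    then have "{e \<in> ?F. e \<subseteq> neighbours E v} = {e \<in> E. e \<subseteq> neighbours E v}"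
      by auto
    ultimately show ?thesis
      unfolding star_sum_def by simp
  qed
qed

text \<open>The weights on \<open>E\<close> are realised as determinants of vectors \<open>(P i, Q i)\<close>. An ear over the edge
  \<open>{a, b}\<close> is a combination of the vectors at \<open>a\<close> and \<open>b\<close> whose coefficients have denominator
  \<open>c {a, b}\<close>, which is why everything stays in \<open>S\<close>.\<close>

lemma determinant_realisation:
  fixes c :: "int set \<Rightarrow> 'a::comm_ring_1" and S :: "'a set"
  assumes "full_triangulation V E" "finite V" "card V \<ge> 2"
    and add: "\<And>x y. x \<in> S \<Longrightarrow> y \<in> S \<Longrightarrow> x + y \<in> S" and mult: "\<And>x y. x \<in> S \<Longrightarrow> y \<in> S \<Longrightarrow> x * y \<in> S"
    and "\<And>e. e \<in> E \<Longrightarrow> c e \<in> S" "\<And>e. e \<in> E \<Longrightarrow> \<exists>d \<in> S. c e * d = 1"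
  shows "\<exists>P Q. (\<forall>i \<in> V. \<forall>j \<in> V. i < j \<longrightarrow> P i * Q j - P j * Q i \<in> S) \<and>
    (\<forall>i j. i < j \<and> {i, j} \<in> E \<longrightarrow> P i * Q j - P j * Q i = c {i, j})"
proof -
  have "\<forall>e \<in> E. c e \<in> S \<and> (\<exists>d \<in> S. c e * d = 1) \<Longrightarrow>
    \<exists>P Q. (\<forall>i \<in> V. \<forall>j \<in> V. i < j \<longrightarrow> P i * Q j - P j * Q i \<in> S) \<and>
      (\<forall>i j. i < j \<and> {i, j} \<in> E \<longrightarrow> P i * Q j - P j * Q i = c {i, j})"
    using assms(1-3)
  proof (induction rule: full_triangulation_induct)
    case (base a b)
    then show ?case
      \<comment> \<open>The vectors \<open>(1, 0)\<close> at \<open>a\<close> and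
        \<open>(0, c {a, b})\<close> at \<open>b\<close> have the prescribed determinant.\<close>
      by (intro exI[of _ "\<lambda>i. if i = a then 1 else 0"] exI[of _ "\<lambda>i. if i = b then c {a, b} else 0"])
        (auto simp: doubleton_eq_iff)
  next
    case (ear V E a w b)
    have V: "a \<in> V" "b \<in> V" "{a, b} \<in> E" "w \<notin> V" "a < w" "w < b" and gap: "\<And>u. u \<in> V \<Longrightarrow> u \<le> a \<or> b \<le> u"
      using ear.hyps(4) unfolding ear_def by auto
    have wE: "w \<notin> e" if "e \<in> E" for e
      using edge_endpoints[OF ear.hyps(1) that] V by blast
    obtain P Q where S: "\<And>i j. i \<in> V \<Longrightarrow> j \<in> V \<Longrightarrow> i < j \<Longrightarrow> P i * Q j - P j * Q i \<in> S"
      and E: "\<And>i j. i < j \<Longrightarrow> {i, j} \<in> E \<Longrightarrow> P i * Q j - P j * Q i = c {i, j}"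
      using ear.IH ear.prems by (metis insertCI)
    obtain d where d: "d \<in> S" "c {a, b} * d = 1"
      using ear.prems V by auto
    \<comment> \<open>Cramer's rule: these coefficients are forced by the prescribed determinants of
      the new vector with those at \<open>a\<close> and \<open>b\<close>.\<close>
    define \<alpha> where "\<alpha> = c {w, b} * d"
    define \<beta> where "\<beta> = c {a, w} * d"
    have c: "c {a, w} \<in> S" "c {w, b} \<in> S"
      using ear.prems by auto
    have \<alpha>\<beta>: "\<alpha> \<in> S" "\<beta> \<in> S"
      unfolding \<alpha>_def \<beta>_def using c d(1) mult by auto
    define P' where "P' = P(w := \<alpha> * P a + \<beta> * P b)"
    define Q' where "Q' = Q(w := \<alpha> * Q a + \<beta> * Q b)"
    have old: "P' i = P i" "Q' i = Q i" if "i \<noteq> w" for i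
      using that unfolding P'_def Q'_def by auto
    have left: "P' i * Q' w - P' w * Q' i = \<alpha> * (P i * Q a - P a * Q i) + \<beta> * (P i * Q b - P b * Q i)"
      and right: "P' w * Q' i - P' i * Q' w = \<alpha> * (P a * Q i - P i * Q a) + \<beta> * (P b * Q i - P i * Q b)"
      if "i \<noteq> w" for i
      using that unfolding P'_def Q'_def by (auto simp: algebra_simps)
    have ab: "P a * Q b - P b * Q a = c {a, b}"
      using E V by auto
    have aw: "P' a * Q' w - P' w * Q' a = c {a, w}"
    proof -
      have "P' a * Q' w - P' w * Q' a = c {a, w} * (c {a, b} * d)"
        using left[of a] V ab unfolding \<beta>_def by (simp add: ac_simps)
      with d(2) show ?thesis by simp
    qed
    have wb: "P' w * Q' b - P' b * Q' w = c {w, b}"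
    proof -
      have "P' w * Q' b - P' b * Q' w = c {w, b} * (c {a, b} * d)"
        using right[of b] V ab unfolding \<alpha>_def by (simp add: ac_simps)
      with d(2) show ?thesis by simp
    qed
    have "P' i * Q' j - P' j * Q' i \<in> S" if ij: "i \<in> insert w V" "j \<in> insert w V" "i < j" for i j
    proof -
      \<comment> \<open>For \<open>i < a\<close> or \<open>b < j\<close> the formulas
        \<open>left\<close> and \<open>right\<close> use only determinants in increasing order. The
        ends \<open>a\<close> and \<open>b\<close> are treated apart, since a vanishing determinant
        need not lie in \<open>S\<close>.\<close>
      have "i \<noteq> w \<and> j \<noteq> w \<or> j = w \<and> (i = a \<or> i < a) \<or> i = w \<and> (j = b \<or> b < j)"
        using ij gap[of i] gap[of j] V(4-6) by auto
      then consider "i \<noteq> w" "j \<noteq> w" | "j = w" "i = a" | "j = w" "i < a" | "i = w" "j = b" | "i = w" "b < j"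
        by blast
      then show ?thesis
      proof cases
        case 1
        then show ?thesis using ij S by (simp add: old)
      next
        case 2
        then show ?thesis using aw c by simp
      next
        case 3
        then have "i \<noteq> w" "i \<in> V" "i < a" "i < b" using ij V(4-6) by auto
        from this(2-) have "\<alpha> * (P i * Q a - P a * Q i) + \<beta> * (P i * Q b - P b * Q i) \<in> S"
          using V(1,2) \<alpha>\<beta> by (intro add mult S) auto
        then show ?thesis
          using 3(1) left[OF \<open>i \<noteq> w\<close>] by simp
      next
        case 4
        then show ?thesis using wb c by simp
      next
        case 5
        then have "j \<noteq> w" "j \<in> V" "a < j" "b < j" using ij V(4-6) by auto
        from this(2-) have "\<alpha> * (P a * Q j - P j * Q a) + \<beta> * (P b * Q j - P j * Q b) \<in> S"
          using V(1,2) \<alpha>\<beta> by (intro add mult S) auto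
        then show ?thesis
          using 5(1) right[OF \<open>j \<noteq> w\<close>] by simp
      qed
    qed
    moreover have "P' i * Q' j - P' j * Q' i = c {i, j}"
      if ij: "i < j" "{i, j} \<in> insert {a, w} (insert {w, b} E)" for i j
    proof -
      have "{i, j} = {a, w} \<or> {i, j} = {w, b} \<or> {i, j} \<in> E"
        using ij(2) by blast
      then have "i = a \<and> j = w \<or> i = w \<and> j = b \<or> {i, j} \<in> E \<and> i \<noteq> w \<and> j \<noteq> w"
        using ij(1) V(5,6) wE[of "{i, j}"] by (auto simp: doubleton_eq_iff)
      then consider "i = a" "j = w" | "i = w" "j = b" | "{i, j} \<in> E" "i \<noteq> w" "j \<noteq> w"
        by blast
      then show ?thesis
      proof cases
        case 1
        then show ?thesis using aw by simp
      next
        case 2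
        then show ?thesis using wb by simp
      next
        case 3
        then show ?thesis using E[OF ij(1)] by (simp add: old)
      qed
    qed
    ultimately show ?case by blast
  qed
  with assms(6,7) show ?thesis by blast
qed

section \<open>Symmetries of friezes\<close>

text \<open>Reads a family on the strip as a function on unordered pairs, the form required by
  \<open>ptolemy\<close>.\<close>

definition seg_value :: "(int \<times> int \<Rightarrow> 'a) \<Rightarrow> int set \<Rightarrow> 'a" where
  "seg_value W e = W (Min e, Max e)"

lemma seg_value_pair: "a \<le> b \<Longrightarrow> seg_value W {a, b} = W (a, b)"
  unfolding seg_value_def by (simp add: min_def max_def)

text \<open>The frieze rules over an integral domain; nonzero boundary and interior entries let
  cancellation stand in for division.\<close>

locale nonzero_frieze =
  fixes n :: int and y :: "int \<Rightarrow> 'a::idom" and W :: "int \<times> int \<Rightarrow> 'a"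
  assumes n: "n \<ge> 3"
    and y_nz: "y i \<noteq> 0"
    and W_diag: "W (i, i) = 0" "W (i, i + n) = 0"
    and W_side: "W (i, i + 1) = y i" "W (i, i + n - 1) = y (i - 1)"
    and W_interior: "2 \<le> j - i \<Longrightarrow> j - i \<le> n - 2 \<Longrightarrow> W (i, j) \<noteq> 0"
    and diamond: "i < j \<Longrightarrow> j < i + n \<Longrightarrow>
      W (i, j) * W (i + 1, j + 1) - W (i + 1, j) * W (i, j + 1) = y i * y j"
begin

lemma W_nz:
  assumes "i < j" "j < i + n"
  shows "W (i, j) \<noteq> 0"
proof -
  consider "j = i + 1" | "j = i + n - 1" | "2 \<le> j - i" "j - i \<le> n - 2"
    using assms by linarith
  then show ?thesis
    using W_side y_nz W_interior by cases auto
qed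

text \<open>Two adjacent diamonds show that the left side divided by \<open>W (i, j)\<close> does
  not change when \<open>i\<close> is replaced by \<open>i + 1\<close>; at \<open>i = j - 1\<close>
  the quotient is \<open>W (j - 1, j + 1)\<close>.\<close>

lemma row_recurrence:
  assumes "i < j" "j < i + n"
  shows "y (j - 1) * W (i, j + 1) + y j * W (i, j - 1) = W (j - 1, j + 1) * W (i, j)"
  using assms
proof (induction "nat (j - i)" arbitrary: i rule: less_induct)
  case less
  show ?case
  proof (cases "i = j - 1")
    case True
    then show ?thesis using W_diag(1) W_side(1)[of "j - 1"] by (simp add: mult.commute)
  next
    case False
    with less.prems have ij: "i + 1 < j" by simp
    have IH: "y (j - 1) * W (i + 1, j + 1) + y j * W (i + 1, j - 1) = W (j - 1, j + 1) * W (i + 1, j)"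
      using less.hyps[of "i + 1"] less.prems ij by auto
    have 1: "W (i, j - 1) * W (i + 1, j) - W (i + 1, j - 1) * W (i, j) = y i * y (j - 1)"
      using diamond[of i "j - 1"] less.prems(2) ij by simp
    have 2: "W (i, j) * W (i + 1, j + 1) - W (i + 1, j) * W (i, j + 1) = y i * y j"
      using diamond[of i j] less.prems ij by simp
    \<comment> \<open>Add \<open>y j\<close> times the first diamond to \<open>-y (j - 1)\<close>
      times the second: the right-hand sides cancel.\<close>
    have "W (i + 1, j) * (y (j - 1) * W (i, j + 1) + y j * W (i, j - 1))
        = W (i, j) * (y (j - 1) * W (i + 1, j + 1) + y j * W (i + 1, j - 1))"
      using 1 2 by algebra
    also have "\<dots> = W (i + 1, j) * (W (j - 1, j + 1) * W (i, j))"
      unfolding IH by simp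
    finally show ?thesis
      using W_nz[of "i + 1" j] ij less.prems by simp
  qed
qed

text \<open>The mirror image of \<open>row_recurrence\<close>, with a coefficient of the same form;
  this agreement is what yields the glide symmetry.\<close>

lemma column_recurrence:
  assumes "i < j" "j < i + n"
  shows "y i * W (i - 1, j) + y (i - 1) * W (i + 1, j) = W (i - 1, i + 1) * W (i, j)"
  using assms
proof (induction "nat (j - i)" arbitrary: j rule: less_induct)
  case less
  show ?case
  proof (cases "j = i + 1")
    case True
    then show ?thesis using W_diag(1) W_side(1)[of i] by (simp add: mult.commute)
  next
    case False
    define k where "k = j - 1"
    have j: "j = k + 1" and ik: "i < k" "k + 1 < i + n"
      using less.prems False by (auto simp: k_def)
    have IH: "y i * W (i - 1, k) + y (i - 1) * W (i + 1, k) = W (i - 1, i + 1) * W (i, k)"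
      using less.hyps[of k] ik j by auto
    have 1: "W (i - 1, k) * W (i, k + 1) - W (i, k) * W (i - 1, k + 1) = y (i - 1) * y k"
      using diamond[of "i - 1" k] ik by simp
    have 2: "W (i, k) * W (i + 1, k + 1) - W (i + 1, k) * W (i, k + 1) = y i * y k"
      using diamond[of i k] ik by simp
    have "W (i, k) * (y i * W (i - 1, k + 1) + y (i - 1) * W (i + 1, k + 1))
        = W (i, k + 1) * (y i * W (i - 1, k) + y (i - 1) * W (i + 1, k))"
      using 1 2 by algebra
    also have "\<dots> = W (i, k) * (W (i - 1, i + 1) * W (i, k + 1))"
      unfolding IH by simp
    finally show ?thesis
      using W_nz[of i k] ik unfolding j by simp
  qed
qed

text \<open>As functions of \<open>j\<close>, both sides solve the same second-order recurrence.
  They agree at \<open>j = k\<close> and \<open>j = k + 1\<close> by the two boundary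
  conditions.\<close>

lemma glide:
  assumes "k \<le> j" "j \<le> k + n"
  shows "W (k, j) = W (j, k + n)"
  using assms
proof (induction "nat (j - k)" arbitrary: j rule: less_induct)
  case less
  consider "j = k" | "j = k + 1" | "k + 2 \<le> j"
    using less.prems by linarith
  then show ?case
  proof cases
    case 1
    then show ?thesis using W_diag by simp
  next
    case 2
    then show ?thesis using W_side(1)[of k] W_side(2)[of "k + 1"] by (simp add: algebra_simps)
  next
    case 3
    define l where "l = j - 1"
    have j: "j = l + 1" and kl: "k < l" "l < k + n"
      using less.prems 3 by (auto simp: l_def)
    have IH: "W (k, l) = W (l, k + n)" "W (k, l - 1) = W (l - 1, k + n)"
      using less.hyps kl j by auto
    have "y (l - 1) * W (k, l + 1) + y l * W (k, l - 1) = W (l - 1, l + 1) * W (k, l)"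
      using row_recurrence kl by simp
    moreover have "y l * W (l - 1, k + n) + y (l - 1) * W (l + 1, k + n) = W (l - 1, l + 1) * W (l, k + n)"
      using column_recurrence kl by simp
    ultimately have "y (l - 1) * W (k, l + 1) = y (l - 1) * W (l + 1, k + n)"
      unfolding IH by algebra
    then show ?thesis
      using y_nz j by simp
  qed
qed

text \<open>Two glides compose to a translation by \<open>n\<close>.\<close>

lemma periodic:
  assumes "i \<le> j" "j \<le> i + n"
  shows "W (i + q * n, j + q * n) = W (i, j)"
proof -
  have step: "W (i + n, j + n) = W (i, j)" if "i \<le> j" "j \<le> i + n" for i j
    using glide[of i j] glide[of j "i + n"] that by simp
  show ?thesis
  proof (induction q rule: int_induct[of _ 0])
    case (step1 q)
    then show ?case
      using step[of "i + q * n" "j + q * n"] assms by (simp add: algebra_simps)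
  next
    case (step2 q)
    then show ?case
      using step[of "i + (q - 1) * n" "j + (q - 1) * n"] assms by (simp add: algebra_simps)
  qed simp
qed

text \<open>The Casorati determinant of two solutions of the row recurrence: each step multiplies it
  by \<open>y k / y (k - 1)\<close>, and at \<open>k = j\<close> it equals
  \<open>W (i, j) * y j\<close>.\<close>

lemma wronskian:
  assumes "i \<le> j" "j \<le> k" "k < i + n"
  shows "W (i, k) * W (j, k + 1) - W (i, k + 1) * W (j, k) = W (i, j) * y k"
  using assms(2,3)
proof (induction "nat (k - j)" arbitrary: k rule: less_induct)
  case less
  show ?case
  proof (cases "k = j")
    case True
    then show ?thesis using W_diag(1) W_side(1) by simp
  next
    case False
    have IH: "W (i, k - 1) * W (j, k) - W (i, k) * W (j, k - 1) = W (i, j) * y (k - 1)"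
      using less.hyps[of "k - 1"] less.prems False by simp
    have 1: "y (k - 1) * W (i, k + 1) + y k * W (i, k - 1) = W (k - 1, k + 1) * W (i, k)"
      using row_recurrence[of i k] less.prems False assms(1) by simp
    have 2: "y (k - 1) * W (j, k + 1) + y k * W (j, k - 1) = W (k - 1, k + 1) * W (j, k)"
      using row_recurrence[of j k] less.prems False assms(1) by simp
    have "y (k - 1) * (W (i, k) * W (j, k + 1) - W (i, k + 1) * W (j, k)) = y (k - 1) * (W (i, j) * y k)"
      using IH 1 2 by algebra
    then show ?thesis using y_nz by simp
  qed
qed

text \<open>Both sides solve the row recurrence in \<open>l\<close>. They agree trivially at
  \<open>l = k\<close>, and at \<open>l = k + 1\<close> by \<open>wronskian\<close>.\<close>

lemma ptolemy_strip:
  assumes "i \<le> j" "j \<le> k" "k \<le> l" "l \<le> i + n"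
  shows "W (i, k) * W (j, l) = W (i, j) * W (k, l) + W (i, l) * W (j, k)"
  using assms(3,4)
proof (induction "nat (l - k)" arbitrary: l rule: less_induct)
  case less
  consider "l = k" | "l = k + 1" | "k + 2 \<le> l"
    using less.prems by linarith
  then show ?case
  proof cases
    case 1
    then show ?thesis using W_diag by simp
  next
    case 2
    then show ?thesis
      using wronskian[of i j k] W_side(1)[of k] assms(1,2) less.prems by (simp add: algebra_simps)
  next
    case 3
    define p where "p = l - 1"
    have l: "l = p + 1" and kp: "k < p" "p < i + n"
      using less.prems 3 by (auto simp: p_def)
    have IH: "W (i, k) * W (j, p) = W (i, j) * W (k, p) + W (i, p) * W (j, k)"
      "W (i, k) * W (j, p - 1) = W (i, j) * W (k, p - 1) + W (i, p - 1) * W (j, k)"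
      using less.hyps kp l by auto
    have rec: "y (p - 1) * W (t, p + 1) + y p * W (t, p - 1) = W (p - 1, p + 1) * W (t, p)"
      if "i \<le> t" "t \<le> k" for t
      using row_recurrence[of t p] that kp assms(1,2) by simp
    have "y (p - 1) * (W (i, k) * W (j, p + 1))
        = y (p - 1) * (W (i, j) * W (k, p + 1) + W (i, p + 1) * W (j, k))"
      using IH rec[OF order_refl order.trans[OF assms(1,2)]] rec[OF assms(1,2)]
        rec[OF order.trans[OF assms(1,2)] order_refl] by algebra
    then show ?thesis
      using y_nz unfolding l by simp
  qed
qed

lemma ptolemy_seg_value: "ptolemy {1..n} (seg_value W)"
  unfolding ptolemy_def
proof (intro conjI allI ballI impI)
  show "seg_value W {a} = 0" for a
    unfolding seg_value_def using W_diag by simp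
  fix a b c d assume "a \<in> {1..n}" "b \<in> {1..n}" "c \<in> {1..n}" "d \<in> {1..n}" "a < b \<and> b < c \<and> c < d"
  then show "seg_value W {a, c} * seg_value W {b, d} = seg_value W {a, b} * seg_value W {c, d} + seg_value W {a, d} * seg_value W {b, c}"
    using ptolemy_strip[of a b c d] by (simp add: seg_value_pair)
qed

end

section \<open>Reduction of indices modulo n\<close>

lemma cyc_range: "cyc m i \<in> {1..gon m}"
proof -
  have "0 < gon m" by simp
  from pos_mod_bound[OF this, of "i - 1"] pos_mod_sign[OF this, of "i - 1"]
  show ?thesis unfolding cyc_def atLeastAtMost_iff by linarith
qed

lemma cyc_id: "1 \<le> i \<Longrightarrow> i \<le> gon m \<Longrightarrow> cyc m i = i"
  unfolding cyc_def by simp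

lemma cyc_succ: "cyc m (i + 1) = (if cyc m i = gon m then 1 else cyc m i + 1)"
proof -
  have "cyc m (i + 1) = cyc m i mod gon m + 1"
    unfolding cyc_def by (simp add: mod_simps)
  then show ?thesis
    using cyc_range[of m i] by (auto simp: mod_pos_pos_trivial)
qed

text \<open>A translation by a multiple of the period brings \<open>i\<close> into
  \<open>{1..n}\<close>; if \<open>j\<close> then still exceeds \<open>n\<close>, one glide moves it
  back and exchanges the roles of the two indices.\<close>

lemma seg_value_cyc:
  assumes "nonzero_frieze (gon m) y W" "i \<le> j" "j \<le> i + gon m"
  shows "W (i, j) = seg_value W {cyc m i, cyc m j}"
proof -
  interpret nonzero_frieze "gon m" y W by fact
  define q where "q = (i - 1) div gon m"
  define i' where "i' = i - q * gon m"
  define j' where "j' = j - q * gon m"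
  have i': "i' = cyc m i"
    unfolding i'_def q_def cyc_def using minus_div_mult_eq_mod[of "i - 1" "gon m"] by simp
  have b: "1 \<le> i'" "i' \<le> gon m"
    unfolding i' using cyc_range[of m i] by auto
  have ij: "i' \<le> j'" "j' \<le> i' + gon m"
    using assms(2,3) unfolding i'_def j'_def by auto
  have W: "W (i, j) = W (i', j')"
    using periodic[OF ij, of q] unfolding i'_def j'_def by simp
  have c: "cyc m j = (j' - 1) mod gon m + 1"
    unfolding cyc_def j'_def by (simp add: algebra_simps mod_diff_eq flip: mod_mult_self1[of "j-1" "-q" "gon m"])
  show ?thesis
  proof (cases "j' \<le> gon m")
    case True
    then have "cyc m j = j'" unfolding c using ij b by simp
    then show ?thesis unfolding W using ij(1) i' by (simp add: seg_value_pair)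
  next
    case False
    then have "(j' - 1) mod gon m = j' - 1 - gon m"
      using ij b by (intro int_mod_pos_eq[of _ _ 1]) auto
    then have "cyc m j = j' - gon m" unfolding c by simp
    moreover have "W (i', j') = W (j' - gon m, i')"
      using glide[of "j' - gon m" i'] ij b False by simp
    ultimately show ?thesis
      unfolding W using seg_value_pair[of "j' - gon m" i' W] ij i' by (simp add: insert_commute)
  qed
qed

section \<open>Positive Laurent polynomials\<close>

text \<open>A linear order on the variables makes the Laurent polynomials an integral domain.\<close>

instantiation lvar :: linorder
begin

fun less_eq_lvar :: "lvar \<Rightarrow> lvar \<Rightarrow> bool" where
  "less_eq_lvar (X a) (X b) = (a \<le> b)"
| "less_eq_lvar (X a) (Y b) = True"
| "less_eq_lvar (Y a) (X b) = False"
| "less_eq_lvar (Y a) (Y b) = (a \<le> b)"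

definition less_lvar :: "lvar \<Rightarrow> lvar \<Rightarrow> bool" where
  "less_lvar u v \<longleftrightarrow> u \<le> v \<and> \<not> v \<le> u"

instance
proof
  fix u v w :: lvar
  show "(u < v) = (u \<le> v \<and> \<not> v \<le> u)" by (rule less_lvar_def)
  show "u \<le> u" by (cases u) auto
  show "u \<le> v \<Longrightarrow> v \<le> w \<Longrightarrow> u \<le> w" by (cases u; cases v; cases w) auto
  show "u \<le> v \<Longrightarrow> v \<le> u \<Longrightarrow> u = v" by (cases u; cases v) auto
  show "u \<le> v \<or> v \<le> u" by (cases u; cases v) auto
qed

end

lemma Sum_any_nonneg:
  fixes f :: "'a \<Rightarrow> int"
  shows "(\<And>a. 0 \<le> f a) \<Longrightarrow> 0 \<le> Sum_any f"
  unfolding Sum_any.expand_set by (rule sum_nonneg)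

lemma nonneg_coeffs_add: "nonneg_coeffs p \<Longrightarrow> nonneg_coeffs q \<Longrightarrow> nonneg_coeffs (p + q)"
  unfolding nonneg_coeffs_def by (simp add: lookup_add)

lemma nonneg_coeffs_mult:
  assumes "nonneg_coeffs p" "nonneg_coeffs q"
  shows "nonneg_coeffs (p * q)"
  using assms unfolding nonneg_coeffs_def lookup_mult
  by (intro allI Sum_any_nonneg mult_nonneg_nonneg) (auto simp: when_def)

lemma laurent_ring_add: "p \<in> laurent_ring m \<Longrightarrow> q \<in> laurent_ring m \<Longrightarrow> p + q \<in> laurent_ring m"
  unfolding laurent_ring_def using keys_add[of p q] by blast

lemma laurent_ring_mult:
  assumes "p \<in> laurent_ring m" "q \<in> laurent_ring m"
  shows "p * q \<in> laurent_ring m"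
  unfolding laurent_ring_def
proof (intro CollectI ballI)
  fix c assume "c \<in> Poly_Mapping.keys (p * q)"
  then obtain a b where c: "c = a + b" and ab: "a \<in> Poly_Mapping.keys p" "b \<in> Poly_Mapping.keys q"
    using keys_mult[of p q] by blast
  have "Poly_Mapping.keys c \<subseteq> Poly_Mapping.keys a \<union> Poly_Mapping.keys b"
    unfolding c by (rule keys_add)
  also have "\<dots> \<subseteq> X ` {1..m} \<union> Y ` {1..gon m}"
    using assms ab unfolding laurent_ring_def by blast
  finally show "Poly_Mapping.keys c \<subseteq> X ` {1..m} \<union> Y ` {1..gon m}" .
qed

text \<open>Zero is excluded: without cancellation the set is still closed under sums and products,
  and it can serve as \<open>S\<close> in \<open>determinant_realisation\<close>.\<close>

definition positive_laurent :: "nat \<Rightarrow> laurent set" where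
  "positive_laurent m = {p \<in> laurent_ring m. nonneg_coeffs p \<and> p \<noteq> 0}"

lemma nonzero_lookup: "p \<noteq> 0 \<Longrightarrow> \<exists>a. Poly_Mapping.lookup p a \<noteq> 0"
  using poly_mapping_eqI[of p 0] by auto

lemma positive_laurent_add:
  assumes "p \<in> positive_laurent m" "q \<in> positive_laurent m"
  shows "p + q \<in> positive_laurent m"
proof -
  obtain a where "Poly_Mapping.lookup p a \<noteq> 0"
    using assms(1) nonzero_lookup unfolding positive_laurent_def by blast
  moreover have "0 \<le> Poly_Mapping.lookup p a" "0 \<le> Poly_Mapping.lookup q a"
    using assms unfolding positive_laurent_def nonneg_coeffs_def by auto
  ultimately have "Poly_Mapping.lookup (p + q) a \<noteq> 0"
    unfolding lookup_add by linarith
  then have "p + q \<noteq> 0" by auto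
  then show ?thesis
    using assms nonneg_coeffs_add laurent_ring_add unfolding positive_laurent_def by auto
qed

lemma positive_laurent_mult: "p \<in> positive_laurent m \<Longrightarrow> q \<in> positive_laurent m \<Longrightarrow> p * q \<in> positive_laurent m"
  unfolding positive_laurent_def by (auto intro: nonneg_coeffs_mult laurent_ring_mult)

text \<open>Nothing cancels, so both summands would be supported at the single exponent. Integrality
  makes each coefficient there at least 1, whereas a monomial has coefficient exactly 1.\<close>

lemma positive_sum_not_monomial:
  assumes "p \<in> positive_laurent m" "q \<in> positive_laurent m"
  shows "\<not> laurent_monomial (p + q)"
proof
  assume "laurent_monomial (p + q)"
  then obtain a where a: "p + q = Poly_Mapping.single a 1"
    unfolding laurent_monomial_def by blast
  have nn: "0 \<le> Poly_Mapping.lookup p b" "0 \<le> Poly_Mapping.lookup q b" for b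
    using assms unfolding positive_laurent_def nonneg_coeffs_def by auto
  have sum: "Poly_Mapping.lookup p b + Poly_Mapping.lookup q b = (1 when a = b)" for b
    using arg_cong[OF a, of "\<lambda>p. Poly_Mapping.lookup p b"] by (simp add: lookup_add lookup_single)
  have "Poly_Mapping.lookup r a \<ge> 1"
    if "r \<noteq> 0" "\<And>b. 0 \<le> Poly_Mapping.lookup r b" "\<And>b. b \<noteq> a \<Longrightarrow> Poly_Mapping.lookup r b = 0" for r :: laurent
  proof -
    have "\<exists>b. Poly_Mapping.lookup r b \<noteq> 0"
      using that(1) by (rule nonzero_lookup)
    then have "Poly_Mapping.lookup r a \<noteq> 0" using that(3) by metis
    with that(2)[of a] show ?thesis by linarith
  qed
  moreover have "Poly_Mapping.lookup p b = 0" "Poly_Mapping.lookup q b = 0" if "b \<noteq> a" for b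
    using sum[of b] nn[of b] that by auto
  moreover have "p \<noteq> 0" "q \<noteq> 0"
    using assms unfolding positive_laurent_def by auto
  ultimately have "Poly_Mapping.lookup p a \<ge> 1" "Poly_Mapping.lookup q a \<ge> 1"
    using nn by blast+
  with sum[of a] show False by simp
qed

lemma laurent_monomial_mult: "laurent_monomial p \<Longrightarrow> laurent_monomial q \<Longrightarrow> laurent_monomial (p * q)"
  unfolding laurent_monomial_def by (metis mult_single mult_1)

lemma laurent_monomial_var: "laurent_monomial (laurent_var v)"
  unfolding laurent_monomial_def laurent_var_def by blast

lemma single_positive_laurent:
  assumes "Poly_Mapping.keys a \<subseteq> X ` {1..m} \<union> Y ` {1..gon m}"
  shows "Poly_Mapping.single a 1 \<in> positive_laurent m"
proof -
  have "Poly_Mapping.lookup (Poly_Mapping.single a (1::int)) a \<noteq> 0"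
    by simp
  then have "Poly_Mapping.single a (1::int) \<noteq> 0"
    by auto
  then show ?thesis
    using assms unfolding positive_laurent_def laurent_ring_def nonneg_coeffs_def
    by (auto simp: lookup_single when_def)
qed

lemma laurent_var_unit:
  assumes "v \<in> X ` {1..m} \<union> Y ` {1..gon m}"
  shows "laurent_var v \<in> positive_laurent m" "\<exists>q \<in> positive_laurent m. laurent_var v * q = 1"
proof -
  show "laurent_var v \<in> positive_laurent m"
    unfolding laurent_var_def using assms by (intro single_positive_laurent) auto
  have "Poly_Mapping.single (Poly_Mapping.single v (- 1)) 1 \<in> positive_laurent m"
    using assms by (intro single_positive_laurent) auto
  moreover have "laurent_var v * Poly_Mapping.single (Poly_Mapping.single v (- 1)) 1 = 1"
    unfolding laurent_var_def mult_single by (simp flip: single_add)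
  ultimately show "\<exists>q \<in> positive_laurent m. laurent_var v * q = 1" by blast
qed

lemma laurent_var_inj: "laurent_var u = laurent_var v \<longleftrightarrow> u = v"
proof
  assume "laurent_var u = laurent_var v"
  then have "Poly_Mapping.keys (laurent_var u) = Poly_Mapping.keys (laurent_var v)" by simp
  then have "Poly_Mapping.single u (1::int) = Poly_Mapping.single v 1"
    unfolding laurent_var_def by simp
  then have "Poly_Mapping.keys (Poly_Mapping.single u (1::int)) = Poly_Mapping.keys (Poly_Mapping.single v (1::int))"
    by simp
  then show "u = v" by simp
qed simp

lemma unit_inverse_eqI: "p * q = 1 \<Longrightarrow> unit_inverse p = q"
  unfolding unit_inverse_def
proof (rule the_equality)
  fix r assume "p * q = 1" "p * r = 1"
  then have "p * q * r = r" "p * r * q = q" by simp_all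
  then show "r = q" by (simp only: ac_simps)
qed

section \<open>Friezes of weighted triangulations\<close>

abbreviation polygon :: "nat \<Rightarrow> int set" where
  "polygon m \<equiv> {1..gon m}"

lemma boundary_edges_iff:
  "e \<in> boundary_edges m \<longleftrightarrow> (\<exists>k. 1 \<le> k \<and> k < gon m \<and> e = {k, k + 1}) \<or> e = {1, gon m}"
proof
  assume "e \<in> boundary_edges m"
  then obtain i where i: "e = {cyc m i, cyc m (i + 1)}"
    unfolding boundary_edges_def seg_def by blast
  then show "(\<exists>k. 1 \<le> k \<and> k < gon m \<and> e = {k, k + 1}) \<or> e = {1, gon m}"
    using cyc_range[of m i] unfolding cyc_succ by (cases "cyc m i = gon m") auto
next
  assume "(\<exists>k. 1 \<le> k \<and> k < gon m \<and> e = {k, k + 1}) \<or> e = {1, gon m}"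
  then consider k where "1 \<le> k" "k < gon m" "e = {k, k + 1}" | "e = {gon m, 1}"
    by auto
  then show "e \<in> boundary_edges m"
  proof cases
    case 1
    then have "e = seg m k (k + 1)"
      unfolding seg_def by (simp add: cyc_id)
    then show ?thesis unfolding boundary_edges_def by blast
  next
    case 2
    then have "e = seg m (gon m) (gon m + 1)"
      unfolding seg_def cyc_succ by (simp add: cyc_id)
    then show ?thesis unfolding boundary_edges_def by blast
  qed
qed

lemma boundary_pair_iff:
  assumes "1 \<le> i" "i < j" "j \<le> gon m"
  shows "{i, j} \<in> boundary_edges m \<longleftrightarrow> j = i + 1 \<or> i = 1 \<and> j = gon m"
  unfolding boundary_edges_iff using assms by (auto simp: doubleton_eq_iff)

lemma boundary_subset_pairs: "boundary_edges m \<subseteq> pairs (polygon m)"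
  by (auto simp: boundary_edges_iff)

lemma polygon_diagonals_eq: "polygon_diagonals m = pairs (polygon m) - boundary_edges m"
  unfolding polygon_diagonals_def pairs_def ..

lemma boundary_not_crossing:
  assumes "e \<in> boundary_edges m" "f \<in> pairs (polygon m)"
  shows "\<not> crossing e f"
proof -
  obtain a b where f: "f = {a, b}" "a < b" "a \<in> polygon m" "b \<in> polygon m"
    using assms(2) by (elim pairsE)
  consider k where "e = {k, k + 1}" | "e = {1, gon m}"
    using assms(1) unfolding boundary_edges_iff by blast
  then show ?thesis
    using f by cases (auto simp: crossing_pairs)
qed

lemma noncrossing_edges:
  assumes "D \<subseteq> polygon_diagonals m" "noncrossing D"
  shows "boundary_edges m \<union> D \<subseteq> pairs (polygon m)" "noncrossing (boundary_edges m \<union> D)"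
proof -
  show *: "boundary_edges m \<union> D \<subseteq> pairs (polygon m)"
    using assms(1) boundary_subset_pairs unfolding polygon_diagonals_eq by blast
  show "noncrossing (boundary_edges m \<union> D)"
    unfolding noncrossing_def
  proof (intro ballI)
    fix e f assume ef: "e \<in> boundary_edges m \<union> D" "f \<in> boundary_edges m \<union> D"
    show "\<not> crossing e f"
    proof (cases "e \<in> D \<and> f \<in> D")
      case True
      then show ?thesis using assms(2) unfolding noncrossing_def by blast
    next
      case False
      then show ?thesis
        using ef * boundary_not_crossing crossing_sym by blast
    qed
  qed
qed

lemma triangulation_full:
  assumes "triangulation m D"
  shows "full_triangulation (polygon m) (boundary_edges m \<union> D)"
proof -
  have "D \<subseteq> polygon_diagonals m" "noncrossing D"
    using assms unfolding triangulation_def noncrossing_def by auto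
  note noncrossing_edges[OF this]
  moreover have "\<exists>f \<in> boundary_edges m \<union> D. crossing e f" if "e \<in> pairs (polygon m) - (boundary_edges m \<union> D)" for e
  proof -
    have "e \<in> polygon_diagonals m - D"
      using that unfolding polygon_diagonals_eq by blast
    then show ?thesis
      using assms unfolding triangulation_def by blast
  qed
  ultimately show ?thesis
    unfolding full_triangulation_def by blast
qed

lemma finite_boundary_edges: "finite (boundary_edges m)"
  using boundary_subset_pairs finite_pairs finite_subset by (metis finite_atLeastAtMost_int)

lemma card_boundary_edges: "card (boundary_edges m) = m + 3"
proof -
  let ?f = "\<lambda>k. {k, k + 1}"
  have "boundary_edges m = insert {1, gon m} (?f ` {1..<gon m})"
    unfolding set_eq_iff boundary_edges_iff insert_iff image_iff Bex_def atLeastLessThan_iff by blast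
  moreover have "{1, gon m} \<notin> ?f ` {1..<gon m}"
    by (auto simp: doubleton_eq_iff)
  moreover have "inj_on ?f {1..<gon m}"
    by (auto simp: inj_on_def doubleton_eq_iff)
  ultimately show ?thesis
    by (simp add: card_image)
qed

text \<open>A maximal extension has \<open>2 * (m + 3) - 3\<close> edges, of which
  \<open>m + 3\<close> are sides.\<close>

lemma card_noncrossing_diagonals:
  assumes "D \<subseteq> polygon_diagonals m" "noncrossing D"
  shows "finite D" "card D \<le> m"
proof -
  obtain E where E: "boundary_edges m \<union> D \<subseteq> E" "full_triangulation (polygon m) E"
    using noncrossing_extends[OF _ noncrossing_edges[OF assms]] by auto
  have "finite E"
    using finite_full_triangulation[OF E(2)] by simp
  then show "finite D" using E(1) finite_subset by blast
  have "boundary_edges m \<inter> D = {}"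
    using assms(1) unfolding polygon_diagonals_eq by blast
  then have "card (boundary_edges m) + card D = card (boundary_edges m \<union> D)"
    using \<open>finite D\<close> finite_boundary_edges by (simp add: card_Un_disjoint)
  also have "\<dots> \<le> card E"
    using E(1) \<open>finite E\<close> by (rule card_mono[rotated])
  finally have "m + 3 + card D \<le> card E"
    unfolding card_boundary_edges .
  moreover have "card (polygon m) = m + 3" by simp
  ultimately show "card D \<le> m"
    using card_full_triangulation[OF E(2)] by simp
qed

lemma max_noncrossing_triangulation:
  assumes "D \<subseteq> polygon_diagonals m" "noncrossing D" "m \<le> card D"
  shows "triangulation m D"
  unfolding triangulation_def
proof (intro conjI ballI)
  show "D \<subseteq> polygon_diagonals m" by fact
  show "\<not> crossing e f" if "e \<in> D" "f \<in> D" for e f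
    using assms(2) that unfolding noncrossing_def by blast
  fix e assume e: "e \<in> polygon_diagonals m - D"
  show "\<exists>f \<in> D. crossing e f"
  proof (rule ccontr)
    assume nc: "\<not> (\<exists>f \<in> D. crossing e f)"
    have "e \<in> pairs (polygon m)" using e unfolding polygon_diagonals_eq by blast
    then have "\<not> crossing e e"
      by (auto elim!: pairsE simp: crossing_pairs)
    then have "noncrossing (insert e D)"
      using assms(2) nc crossing_sym unfolding noncrossing_def by blast
    moreover have "insert e D \<subseteq> polygon_diagonals m"
      using assms(1) e by blast
    ultimately have "card (insert e D) \<le> m"
      using card_noncrossing_diagonals(2) by blast
    then show False
      using e assms(3) card_noncrossing_diagonals(1)[OF assms(1,2)] by simp
  qed
qed

lemma yvar_unit:
  "yvar m i \<in> positive_laurent m" "\<exists>q \<in> positive_laurent m. yvar m i * q = 1"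
proof -
  have "Y (cyc m i) \<in> X ` {1..m} \<union> Y ` {1..gon m}"
    using cyc_range by (intro UnI2 imageI)
  from laurent_var_unit[OF this]
  show "yvar m i \<in> positive_laurent m" "\<exists>q \<in> positive_laurent m. yvar m i * q = 1"
    unfolding yvar_def .
qed

lemma xvar_unit:
  assumes "k \<in> {1..m}"
  shows "xvar k \<in> positive_laurent m" "\<exists>q \<in> positive_laurent m. xvar k * q = 1"
proof -
  have "X k \<in> X ` {1..m} \<union> Y ` {1..gon m}"
    using assms by (intro UnI1 imageI)
  from laurent_var_unit[OF this]
  show "xvar k \<in> positive_laurent m" "\<exists>q \<in> positive_laurent m. xvar k * q = 1"
    unfolding xvar_def .
qed

lemma inj_xvar: "inj_on xvar A"
  unfolding inj_on_def xvar_def by (simp add: laurent_var_inj)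

lemma positive_frieze_nonzero_frieze:
  assumes "positive_frieze m W"
  shows "nonzero_frieze (gon m) (yvar m) W"
proof
  have D: "decorated_frieze m W" using assms unfolding positive_frieze_def by blast
  show "gon m \<ge> 3" by simp
  show "yvar m i \<noteq> 0" for i
    using yvar_unit(1)[of m i] unfolding positive_laurent_def by blast
  show "W (i, i) = 0" "W (i, i + gon m) = 0" "W (i, i + 1) = yvar m i"
    "W (i, i + gon m - 1) = yvar m (i - 1)" for i
    using D unfolding decorated_frieze_def by blast+
  show "2 \<le> j - i \<Longrightarrow> j - i \<le> gon m - 2 \<Longrightarrow> W (i, j) \<noteq> 0" for i j
    using D unfolding decorated_frieze_def interior_indices_def by blast
  show "W (i, j) * W (i + 1, j + 1) - W (i + 1, j) * W (i, j + 1) = yvar m i * yvar m j"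
    if "i < j" "j < i + gon m" for i j
  proof -
    have "1 \<le> j - i" "j - i \<le> gon m - 1" using that by auto
    then show ?thesis using D unfolding decorated_frieze_def by blast
  qed
qed

context
  fixes m W
  assumes W: "positive_frieze m W"
begin

interpretation nonzero_frieze "gon m" "yvar m" W
  using W by (rule positive_frieze_nonzero_frieze)

lemma frieze_ptolemy: "ptolemy (polygon m) (seg_value W)"
  by (rule ptolemy_seg_value)

lemma frieze_entry: "(i, j) \<in> strip m \<Longrightarrow> W (i, j) = seg_value W {cyc m i, cyc m j}"
  by (rule seg_value_cyc[OF nonzero_frieze_axioms]) (auto simp: strip_def)

lemma seg_value_positive:
  assumes "e \<in> pairs (polygon m)"
  shows "seg_value W e \<in> positive_laurent m"
proof -
  obtain a b where e: "e = {a, b}" "a < b" "a \<in> polygon m" "b \<in> polygon m"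
    using assms by (elim pairsE)
  then have "(a, b) \<in> strip m" "W (a, b) \<noteq> 0"
    using W_nz[of a b] unfolding strip_def by auto
  moreover have "W \<in> strip m \<rightarrow>\<^sub>E laurent_ring m" "\<forall>p \<in> strip m. W p \<noteq> 0 \<longrightarrow> nonneg_coeffs (W p)"
    using W unfolding positive_frieze_def decorated_frieze_def by blast+
  ultimately have "W (a, b) \<in> positive_laurent m"
    unfolding positive_laurent_def by (blast dest: PiE_mem)
  then show ?thesis using e by (simp add: seg_value_pair)
qed

lemma seg_value_boundary: "seg_value W (seg m i (i + 1)) = yvar m i"
proof -
  have "seg_value W (seg m i (i + 1)) = W (i, i + 1)"
    unfolding seg_def by (rule frieze_entry[symmetric]) (simp add: strip_def)
  then show ?thesis using W_side(1) by simp
qed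

text \<open>By Ptolemy, the product of two crossing monomials would be a sum of two nonzero Laurent
  polynomials with nonnegative coefficients.\<close>

lemma crossing_not_monomials:
  assumes "e \<in> pairs (polygon m)" "f \<in> pairs (polygon m)" "crossing e f"
  shows "\<not> (laurent_monomial (seg_value W e) \<and> laurent_monomial (seg_value W f))"
proof
  assume "laurent_monomial (seg_value W e) \<and> laurent_monomial (seg_value W f)"
  then have mono: "laurent_monomial (seg_value W e * seg_value W f)"
    using laurent_monomial_mult by blast
  obtain a b c d where abcd: "a < b" "b < c" "c < d"
    and ef: "e = {a, c} \<and> f = {b, d} \<or> e = {b, d} \<and> f = {a, c}"
    using assms(3) unfolding crossing_def by blast
  then have V: "a \<in> polygon m" "b \<in> polygon m" "c \<in> polygon m" "d \<in> polygon m"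
    using assms(1,2) unfolding pairs_def by blast+
  have "seg_value W e * seg_value W f = seg_value W {a, c} * seg_value W {b, d}"
    using ef by (elim disjE) (simp_all add: mult.commute)
  also have "\<dots> = seg_value W {a, b} * seg_value W {c, d} + seg_value W {a, d} * seg_value W {b, c}"
    using frieze_ptolemy V abcd unfolding ptolemy_def by blast
  finally have "laurent_monomial (seg_value W {a, b} * seg_value W {c, d} + seg_value W {a, d} * seg_value W {b, c})"
    using mono by simp
  moreover have "seg_value W {a, b} * seg_value W {c, d} \<in> positive_laurent m"
    "seg_value W {a, d} * seg_value W {b, c} \<in> positive_laurent m"
    by (rule positive_laurent_mult; rule seg_value_positive; use V abcd in simp)+
  ultimately show False
    using positive_sum_not_monomial by blast
qed

end

lemma interior_pair_iff:
  assumes "1 \<le> i" "i < j" "j \<le> gon m"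
  shows "(i, j) \<in> interior_indices m \<longleftrightarrow> {i, j} \<in> polygon_diagonals m"
  unfolding polygon_diagonals_eq interior_indices_def
  using assms boundary_pair_iff[OF assms] by auto

text \<open>\<open>normalized\<close> speaks of the whole strip, so interior positions must be
  matched with diagonals beyond the range \<open>1 \<le> i < j \<le> n\<close>.\<close>

lemma interior_seg_diagonal:
  assumes "(i, j) \<in> interior_indices m"
  shows "{cyc m i, cyc m j} \<in> polygon_diagonals m" "(i, j) \<in> strip m"
proof -
  have ij: "2 \<le> j - i" "j - i \<le> gon m - 2"
    using assms unfolding interior_indices_def by auto
  then show "(i, j) \<in> strip m" unfolding strip_def by auto
  define q where "q = (i - 1) div gon m"
  have i: "i = cyc m i + q * gon m"
    unfolding q_def cyc_def using div_mult_mod_eq[of "i - 1" "gon m"] by simp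
  define j' where "j' = j - q * gon m"
  have j': "cyc m j = cyc m j'"
    unfolding cyc_def j'_def using mod_mult_self1[of "j - 1 - q * gon m" q "gon m"]
    by (simp add: algebra_simps)
  have b: "2 \<le> j' - cyc m i" "j' - cyc m i \<le> gon m - 2"
    using ij i unfolding j'_def by linarith+
  have c: "1 \<le> cyc m i" "cyc m i \<le> gon m"
    using cyc_range[of m i] by auto
  show "{cyc m i, cyc m j} \<in> polygon_diagonals m"
  proof (cases "j' \<le> gon m")
    case True
    then have "cyc m j = j'" unfolding j' using b c by (intro cyc_id) auto
    then show ?thesis
      using interior_pair_iff[of "cyc m i" j' m] b c True unfolding interior_indices_def by auto
  next
    case False
    have "cyc m j' = cyc m (j' - gon m)"
      unfolding cyc_def using mod_add_self2[of "j' - gon m - 1" "gon m"] by (simp add: algebra_simps)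
    also have "\<dots> = j' - gon m" using b c False by (intro cyc_id) auto
    finally have "cyc m j = j' - gon m" unfolding j' .
    then show ?thesis
      using interior_pair_iff[of "j' - gon m" "cyc m i" m] b c False
      unfolding interior_indices_def by (auto simp: insert_commute)
  qed
qed

section \<open>From weighted triangulations to friezes\<close>

lemma weighted_triangulationD:
  assumes "\<Delta> \<in> weighted_triangulations m"
  shows "full_triangulation (polygon m) (edges m \<Delta>)"
    "\<And>d. d \<in> fst \<Delta> \<Longrightarrow> \<exists>k \<in> {1..m}. wt \<Delta> d = xvar k"
    "\<And>k. k \<in> {1..m} \<Longrightarrow> \<exists>d \<in> fst \<Delta>. wt \<Delta> d = xvar k"
    "\<And>i. wt \<Delta> (seg m i (i + 1)) = yvar m i"
    "fst \<Delta> \<subseteq> polygon_diagonals m"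
    "\<And>e. e \<in> edges m \<Delta> \<Longrightarrow> wt \<Delta> e \<in> positive_laurent m"
    "\<And>e. e \<in> edges m \<Delta> \<Longrightarrow> \<exists>q \<in> positive_laurent m. wt \<Delta> e * q = 1"
    "\<And>e. e \<in> edges m \<Delta> \<Longrightarrow> laurent_monomial (wt \<Delta> e)"
proof -
  have tri: "triangulation m (fst \<Delta>)" and wt: "wt \<Delta> ` fst \<Delta> = xvar ` {1..m}"
    and y: "\<And>i. wt \<Delta> (seg m i (i + 1)) = yvar m i"
    using assms unfolding weighted_triangulations_def bij_betw_def by auto
  show "full_triangulation (polygon m) (edges m \<Delta>)"
    unfolding edges_def by (rule triangulation_full[OF tri])
  show x: "\<exists>k \<in> {1..m}. wt \<Delta> d = xvar k" if "d \<in> fst \<Delta>" for d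
    using wt that by blast
  show "\<exists>d \<in> fst \<Delta>. wt \<Delta> d = xvar k" if "k \<in> {1..m}" for k
    using wt that by (metis image_iff)
  show "wt \<Delta> (seg m i (i + 1)) = yvar m i" for i by (rule y)
  show "fst \<Delta> \<subseteq> polygon_diagonals m"
    using tri unfolding triangulation_def by blast
  fix e assume "e \<in> edges m \<Delta>"
  then consider i where "wt \<Delta> e = yvar m i" | k where "k \<in> {1..m}" "wt \<Delta> e = xvar k"
    using x y unfolding edges_def boundary_edges_def by blast
  then show "wt \<Delta> e \<in> positive_laurent m" "\<exists>q \<in> positive_laurent m. wt \<Delta> e * q = 1" "laurent_monomial (wt \<Delta> e)"
    using yvar_unit[of m] xvar_unit[of _ m] laurent_monomial_var
    by (cases; simp add: yvar_def xvar_def)+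
qed

lemma compatible_iff:
  assumes "full_triangulation (polygon m) (edges m \<Delta>)" "positive_frieze m W"
  shows "compatible m \<Delta> W \<longleftrightarrow> (\<forall>e \<in> edges m \<Delta>. seg_value W e = wt \<Delta> e)"
proof
  assume C: "compatible m \<Delta> W"
  show "\<forall>e \<in> edges m \<Delta>. seg_value W e = wt \<Delta> e"
  proof
    fix e assume e: "e \<in> edges m \<Delta>"
    then have "e \<in> pairs (polygon m)"
      using assms(1) unfolding full_triangulation_def by blast
    then obtain a b where ab: "e = {a, b}" "a < b" "a \<in> polygon m" "b \<in> polygon m"
      by (elim pairsE)
    then have "seg m a b = e"
      unfolding seg_def by (simp add: cyc_id)
    then show "seg_value W e = wt \<Delta> e"
      using C ab e seg_value_pair[of a b W] unfolding compatible_def by auto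
  qed
next
  assume R: "\<forall>e \<in> edges m \<Delta>. seg_value W e = wt \<Delta> e"
  show "compatible m \<Delta> W"
    unfolding compatible_def
  proof (intro allI impI, elim conjE)
    fix i j assume ij: "1 \<le> i" "i < j" "j \<le> gon m" "seg m i j \<in> edges m \<Delta>"
    then have "seg m i j = {i, j}"
      unfolding seg_def by (simp add: cyc_id)
    with ij R show "W (i, j) = wt \<Delta> (seg m i j)"
      using seg_value_pair[of i j W] by auto
  qed
qed

lemma compatible_unique:
  assumes \<Delta>: "\<Delta> \<in> weighted_triangulations m"
    and W: "positive_frieze m W" "compatible m \<Delta> W" and W': "positive_frieze m W'" "compatible m \<Delta> W'"
  shows "W = W'"
proof (rule ext)
  note D = weighted_triangulationD[OF \<Delta>]
  fix p :: "int \<times> int"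
  obtain i j where p: "p = (i, j)" by (cases p)
  show "W p = W' p"
  proof (cases "p \<in> strip m")
    case False
    have "W \<in> strip m \<rightarrow>\<^sub>E laurent_ring m" "W' \<in> strip m \<rightarrow>\<^sub>E laurent_ring m"
      using W(1) W'(1) unfolding positive_frieze_def decorated_frieze_def by blast+
    from this[THEN PiE_arb, OF False] show ?thesis
      by simp
  next
    case True
    have "seg_value W {cyc m i, cyc m j} = seg_value W' {cyc m i, cyc m j}"
    proof (rule ptolemy_unique[OF D(1), where g = "seg_value W" and h = "seg_value W'"])
      fix e assume e: "e \<in> edges m \<Delta>"
      have "seg_value W e = wt \<Delta> e" "seg_value W' e = wt \<Delta> e"
        using e W(2) W'(2) compatible_iff[OF D(1) W(1)] compatible_iff[OF D(1) W'(1)] by blast+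
      moreover have "wt \<Delta> e \<noteq> 0"
        using D(6)[OF e] unfolding positive_laurent_def by blast
      ultimately show "seg_value W e \<noteq> 0" "seg_value W e = seg_value W' e" by simp_all
    next
      show "ptolemy (polygon m) (seg_value W)" "ptolemy (polygon m) (seg_value W')"
        using frieze_ptolemy[OF W(1)] frieze_ptolemy[OF W'(1)] .
      show "2 \<le> card (polygon m)" by simp
    qed (rule cyc_range finite_atLeastAtMost_int)+
    then show ?thesis
      using frieze_entry[OF W(1) True[unfolded p]] frieze_entry[OF W'(1) True[unfolded p]] unfolding p by simp
  qed
qed

text \<open>By maximality, a monomial entry off the triangulation would sit on a diagonal crossing
  some edge, whose weight is also a monomial. Conversely, each variable occurs as the weight of a
  diagonal.\<close>

lemma compatible_normalized:
  assumes \<Delta>: "\<Delta> \<in> weighted_triangulations m" and W: "positive_frieze m W" "compatible m \<Delta> W"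
  shows "normalized m W"
  unfolding normalized_def
proof (intro conjI ballI impI)
  note D = weighted_triangulationD[OF \<Delta>]
  have sv: "seg_value W e = wt \<Delta> e" if "e \<in> edges m \<Delta>" for e
    using compatible_iff[OF D(1) W(1)] W(2) that by blast
  show "W p \<in> xvar ` {1..m}" if p: "p \<in> interior_indices m" "laurent_monomial (W p)" for p
  proof -
    obtain i j where ij: "p = (i, j)" by (cases p)
    define e where "e = {cyc m i, cyc m j}"
    have e: "e \<in> polygon_diagonals m" and "(i, j) \<in> strip m"
      using interior_seg_diagonal[of i j m] p(1) unfolding e_def ij by auto
    have Wp: "W p = seg_value W e"
      unfolding e_def ij by (rule frieze_entry[OF W(1) \<open>(i, j) \<in> strip m\<close>])
    have e': "e \<in> pairs (polygon m)" "e \<notin> boundary_edges m"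
      using e unfolding polygon_diagonals_eq by auto
    have "e \<in> edges m \<Delta>"
    proof (rule ccontr)
      assume "e \<notin> edges m \<Delta>"
      then obtain f where f: "f \<in> edges m \<Delta>" "crossing e f"
        using D(1) e'(1) unfolding full_triangulation_def by blast
      then have "f \<in> pairs (polygon m)"
        using D(1) unfolding full_triangulation_def by blast
      moreover have "laurent_monomial (seg_value W f)"
        unfolding sv[OF f(1)] by (rule D(8)[OF f(1)])
      ultimately show False
        using crossing_not_monomials[OF W(1) e'(1) _ f(2)] p(2) Wp by simp
    qed
    then have "e \<in> fst \<Delta>"
      using e'(2) unfolding edges_def by blast
    then show ?thesis
      using D(2) sv[OF \<open>e \<in> edges m \<Delta>\<close>] Wp by (metis imageI)
  qed
  show "\<exists>p \<in> interior_indices m. W p = xvar k" if k: "k \<in> {1..m}" for k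
  proof -
    obtain d where d: "d \<in> fst \<Delta>" "wt \<Delta> d = xvar k"
      using D(3)[OF k] by blast
    then have dd: "d \<in> polygon_diagonals m" "d \<in> edges m \<Delta>"
      using D(5) unfolding edges_def by auto
    then have "d \<in> pairs (polygon m)"
      unfolding polygon_diagonals_eq by blast
    then obtain a b where ab: "d = {a, b}" "a < b" "a \<in> polygon m" "b \<in> polygon m"
      by (elim pairsE)
    have "(a, b) \<in> interior_indices m"
      using interior_pair_iff[of a b m] ab dd(1) by simp
    moreover have "W (a, b) = xvar k"
      using sv[OF dd(2)] d(2) seg_value_pair[of a b W] ab by simp
    ultimately show ?thesis by blast
  qed
qed

text \<open>Indices less than one period apart lie in the same block of length \<open>n\<close> or
  in adjacent blocks; this decides the sign in the continuation of the vectors.\<close>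

lemma cyc_wrap:
  assumes "i < j" "j < i + gon m"
  shows "(j - 1) div gon m = (i - 1) div gon m \<and> cyc m i < cyc m j \<or>
    (j - 1) div gon m = (i - 1) div gon m + 1 \<and> cyc m j < cyc m i"
proof -
  let ?q = "(i - 1) div gon m" and ?r = "(j - 1) div gon m"
  have g: "0 < gon m" by simp
  have ij: "i = ?q * gon m + cyc m i" "j = ?r * gon m + cyc m j"
    unfolding cyc_def using div_mult_mod_eq[of "i - 1" "gon m"] div_mult_mod_eq[of "j - 1" "gon m"]
    by linarith+
  have "?q \<le> ?r"
    using assms(1) by (intro zdiv_mono1) auto
  moreover have "?r \<le> (i - 1 + gon m) div gon m"
    using assms(2) by (intro zdiv_mono1) auto
  moreover have "(i - 1 + gon m) div gon m = ?q + 1"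
    using g by (intro div_add_self2) linarith
  ultimately consider "?r = ?q" | "?r = ?q + 1" by linarith
  then show ?thesis
  proof cases
    case 1
    then have "j - i = cyc m j - cyc m i"
      using ij by simp
    with 1 assms(1) show ?thesis by linarith
  next
    case 2
    then have "j - i = gon m + (cyc m j - cyc m i)"
      using ij by (simp add: distrib_right)
    with 2 assms(2) show ?thesis by linarith
  qed
qed

text \<open>Vectors at the vertices \<open>1, \<dots>, n\<close> are continued to all integers with period \<open>n\<close> up to sign.\<close>

lemma compatible_frieze_exists:
  assumes \<Delta>: "\<Delta> \<in> weighted_triangulations m"
  shows "\<exists>W. positive_frieze m W \<and> compatible m \<Delta> W"
proof -
  note D = weighted_triangulationD[OF \<Delta>]
  have card: "2 \<le> card (polygon m)" by simp
  have "\<exists>P Q. (\<forall>i \<in> polygon m. \<forall>j \<in> polygon m. i < j \<longrightarrow> P i * Q j - P j * Q i \<in> positive_laurent m) \<and>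
    (\<forall>i j. i < j \<and> {i, j} \<in> edges m \<Delta> \<longrightarrow> P i * Q j - P j * Q i = wt \<Delta> {i, j})"
    by (rule determinant_realisation[where c = "wt \<Delta>", OF D(1) finite_atLeastAtMost_int card])
      (fact positive_laurent_add positive_laurent_mult D(6) D(7))+
  then obtain P Q where PQ: "\<forall>i \<in> polygon m. \<forall>j \<in> polygon m. i < j \<longrightarrow> P i * Q j - P j * Q i \<in> positive_laurent m"
    "\<forall>i j. i < j \<and> {i, j} \<in> edges m \<Delta> \<longrightarrow> P i * Q j - P j * Q i = wt \<Delta> {i, j}"
    by (elim exE conjE)
  have pos: "P i * Q j - P j * Q i \<in> positive_laurent m"
    if "i \<in> polygon m" "j \<in> polygon m" "i < j" for i j
    using PQ(1) that by blast
  have edge: "P i * Q j - P j * Q i = wt \<Delta> {i, j}" if "i < j" "{i, j} \<in> edges m \<Delta>" for i j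
    using PQ(2) that by blast
  \<comment> \<open>The sign flips from one block to the next, so the vector at \<open>i + n\<close>
    is minus the vector at \<open>i\<close>.\<close>
  define s :: "int \<Rightarrow> laurent" where "s i = (if even ((i - 1) div gon m) then 1 else - 1)" for i
  define p where "p i = s i * P (cyc m i)" for i
  define q where "q i = s i * Q (cyc m i)" for i
  define d where "d i j = p i * q j - p j * q i" for i j
  have ss: "s i * s i = 1" for i
    unfolding s_def by simp
  have d_eq: "d i j = s i * s j * (P (cyc m i) * Q (cyc m j) - P (cyc m j) * Q (cyc m i))" for i j
    unfolding d_def p_def q_def by (simp add: algebra_simps)
  have cyc_n: "cyc m (i + gon m) = cyc m i" for i
    unfolding cyc_def using mod_add_self2[of "i - 1" "gon m"] by (simp add: algebra_simps)
  have "(i + gon m - 1) div gon m = (i - 1) div gon m + 1" for i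
  proof -
    have "(i - 1 + gon m) div gon m = (i - 1) div gon m + 1"
      by (intro div_add_self2) linarith
    then show ?thesis by (simp only: diff_add_eq)
  qed
  then have s_n: "s (i + gon m) = - s i" for i
    unfolding s_def by simp
  \<comment> \<open>Across a block boundary the sign change exchanges the two vectors, so
    \<open>d i j\<close> is always a determinant taken at representatives in increasing
    order.\<close>
  have d_wrap: "d i j = (if cyc m i < cyc m j then P (cyc m i) * Q (cyc m j) - P (cyc m j) * Q (cyc m i)
      else P (cyc m j) * Q (cyc m i) - P (cyc m i) * Q (cyc m j)) \<and> cyc m i \<noteq> cyc m j"
    if "i < j" "j < i + gon m" for i j
    using cyc_wrap[OF that]
  proof (elim disjE conjE)
    assume "(j - 1) div gon m = (i - 1) div gon m" and c: "cyc m i < cyc m j"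
    then have "s j = s i" unfolding s_def by simp
    then show ?thesis unfolding d_eq using ss c by simp
  next
    assume "(j - 1) div gon m = (i - 1) div gon m + 1" and c: "cyc m j < cyc m i"
    then have "s j = - s i" unfolding s_def by simp
    then show ?thesis unfolding d_eq using ss c by simp
  qed
  have d_pos: "d i j \<in> positive_laurent m" if "i < j" "j < i + gon m" for i j
    using d_wrap[OF that] pos[OF cyc_range cyc_range, of i j] pos[OF cyc_range cyc_range, of j i]
    by (cases "cyc m i < cyc m j") auto
  have d_edge: "d i j = wt \<Delta> {cyc m i, cyc m j}"
    if "i < j" "j < i + gon m" "{cyc m i, cyc m j} \<in> edges m \<Delta>" for i j
    using d_wrap[OF that(1,2)] edge[of "cyc m i" "cyc m j"] edge[of "cyc m j" "cyc m i"] that(3)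
    by (cases "cyc m i < cyc m j") (auto simp: insert_commute)
  have d_zero: "d i i = 0" "d i (i + gon m) = 0" for i
    unfolding d_eq cyc_n by simp_all
  have d_side: "d i (i + 1) = yvar m i" for i
  proof -
    have "{cyc m i, cyc m (i + 1)} \<in> edges m \<Delta>"
      unfolding edges_def boundary_edges_def seg_def by blast
    then have "d i (i + 1) = wt \<Delta> {cyc m i, cyc m (i + 1)}"
      by (intro d_edge) auto
    then show ?thesis using D(4)[of i] unfolding seg_def by simp
  qed
  have d_side': "d i (i + gon m - 1) = yvar m (i - 1)" for i
  proof -
    have "d i (i - 1 + gon m) = d (i - 1) i"
      unfolding d_eq cyc_n s_n by (simp add: algebra_simps)
    then show ?thesis using d_side[of "i - 1"] by (simp add: algebra_simps)
  qed
  \<comment> \<open>The Pluecker relation for the vectors at \<open>i\<close>, \<open>i + 1\<close>,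
    \<open>j\<close>, \<open>j + 1\<close>.\<close>
  have d_diamond: "d i j * d (i + 1) (j + 1) - d (i + 1) j * d i (j + 1) = yvar m i * yvar m j" for i j
    unfolding d_side[symmetric] unfolding d_def by algebra
  define W where "W = (\<lambda>(i, j). if (i, j) \<in> strip m then d i j else undefined)"
  have W: "W (i, j) = d i j" if "i \<le> j" "j \<le> i + gon m" for i j
    using that unfolding W_def strip_def by auto
  have W_pos: "W (i, j) \<in> positive_laurent m" if "i < j" "j < i + gon m" for i j
    using W[of i j] d_pos[OF that] that by simp
  have W_zero: "W (i, i) = 0" "W (i, i + gon m) = 0" for i
    using W[of i i] W[of i "i + gon m"] d_zero by simp_all
  have strip_cases: "W (i, j) = 0 \<or> W (i, j) \<in> positive_laurent m" if ij: "(i, j) \<in> strip m" for i j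
  proof -
    consider "j = i" | "j = i + gon m" | "i < j" "j < i + gon m"
      using ij unfolding strip_def by fastforce
    then show ?thesis
      using W_zero W_pos by cases simp_all
  qed
  have "decorated_frieze m W"
    unfolding decorated_frieze_def
  proof (intro conjI allI impI)
    have "0 \<in> laurent_ring m" unfolding laurent_ring_def by simp
    then have "W (i, j) \<in> laurent_ring m" if "(i, j) \<in> strip m" for i j
      using strip_cases[OF that] unfolding positive_laurent_def by auto
    then show "W \<in> strip m \<rightarrow>\<^sub>E laurent_ring m"
      by (intro PiE_I) (auto simp: W_def)
    show "W (i, i) = 0" "W (i, i + gon m) = 0" for i
      by (rule W_zero)+
    show "W (i, i + 1) = yvar m i" for i
      using W[of i "i + 1"] d_side by simp
    show "W (i, i + gon m - 1) = yvar m (i - 1)" for i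
      using W[of i "i + gon m - 1"] d_side' by simp
    show "\<forall>(i, j) \<in> interior_indices m. W (i, j) \<noteq> 0"
    proof (intro ballI, clarify)
      fix i j assume "(i, j) \<in> interior_indices m" "W (i, j) = 0"
      then show False
        using W_pos[of i j] unfolding interior_indices_def positive_laurent_def by auto
    qed
    fix i j assume ij: "1 \<le> j - i \<and> j - i \<le> gon m - 1"
    then have "W (i, j) = d i j" "W (i + 1, j + 1) = d (i + 1) (j + 1)" "W (i + 1, j) = d (i + 1) j"
      "W (i, j + 1) = d i (j + 1)"
      by (intro W; linarith)+
    then show "W (i, j) * W (i + 1, j + 1) - W (i + 1, j) * W (i, j + 1) = yvar m i * yvar m j"
      using d_diamond by simp
  qed
  moreover have "\<forall>p \<in> strip m. W p \<noteq> 0 \<longrightarrow> nonneg_coeffs (W p)"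
    using strip_cases unfolding positive_laurent_def by auto
  ultimately have "positive_frieze m W"
    unfolding positive_frieze_def by blast
  moreover have "compatible m \<Delta> W"
    unfolding compatible_def
  proof (intro allI impI, elim conjE)
    fix i j assume ij: "1 \<le> i" "i < j" "j \<le> gon m" "seg m i j \<in> edges m \<Delta>"
    then have "W (i, j) = d i j" by (intro W) auto
    also have "\<dots> = wt \<Delta> (seg m i j)"
      using ij d_edge[of i j] unfolding seg_def by simp
    finally show "W (i, j) = wt \<Delta> (seg m i j)" .
  qed
  ultimately show ?thesis by blast
qed

section \<open>The bijection and the quiddity entries\<close>

lemma next_vertex_cyc: "next_vertex (polygon m) (cyc m i) (cyc m (i + 1))"
  using cyc_range[of m i] unfolding next_vertex_def cyc_succ by auto

lemma bij_betw_neighbours: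
  assumes "full_triangulation V E"
  shows "bij_betw (\<lambda>u. {v, u}) (neighbours E v) {e \<in> E. v \<in> e}"
proof (rule bij_betw_imageI)
  show "inj_on (\<lambda>u. {v, u}) (neighbours E v)"
    by (auto simp: inj_on_def doubleton_eq_iff)
  show "(\<lambda>u. {v, u}) ` neighbours E v = {e \<in> E. v \<in> e}"
  proof (intro equalityI subsetI)
    fix e assume e: "e \<in> {e \<in> E. v \<in> e}"
    then have "e \<in> pairs V"
      using assms unfolding full_triangulation_def by blast
    then obtain a b where "e = {a, b}" "a < b"
      by (elim pairsE)
    with e have "e = {v, if v = a then b else a}" "(if v = a then b else a) \<noteq> v"
      by auto
    then show "e \<in> (\<lambda>u. {v, u}) ` neighbours E v"
      using e unfolding neighbours_def by (intro image_eqI) auto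
  qed (auto simp: neighbours_def)
qed

text \<open>Translates the products over neighbours in \<open>star_formula\<close> into the products
  over edges in \<open>Q_value\<close>.\<close>

lemma prod_neighbours:
  assumes "full_triangulation V E" "A \<subseteq> neighbours E v"
  shows "(\<Prod>u \<in> neighbours E v - A. g {v, u}) = (\<Prod>e \<in> {e \<in> E. v \<in> e} - (\<lambda>u. {v, u}) ` A. g e)"
proof -
  let ?f = "\<lambda>u. {v, u}"
  have inj: "inj_on ?f (neighbours E v)" and image: "?f ` neighbours E v = {e \<in> E. v \<in> e}"
    using bij_betw_neighbours[OF assms(1), of v] unfolding bij_betw_def by blast+
  have "?f ` (neighbours E v - A) = {e \<in> E. v \<in> e} - ?f ` A"
    using inj_on_image_set_diff[OF inj Diff_subset assms(2)] unfolding image .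
  then have "bij_betw ?f (neighbours E v - A) ({e \<in> E. v \<in> e} - ?f ` A)"
    by (rule bij_betw_imageI[OF inj_on_diff[OF inj]])
  then show ?thesis
    by (rule prod.reindex_bij_betw)
qed

lemma frieze_quiddity:
  assumes \<Delta>: "\<Delta> \<in> weighted_triangulations m" and W: "positive_frieze m W" "compatible m \<Delta> W"
  shows "W (i, i + 2) = Q_value m \<Delta> (cyc m (i + 1))"
proof -
  note D = weighted_triangulationD[OF \<Delta>]
  let ?E = "edges m \<Delta>" and ?V = "polygon m"
  define p where "p = cyc m i"
  define v where "v = cyc m (i + 1)"
  define q where "q = cyc m (i + 2)"
  define N where "N = neighbours ?E v"
  have sv: "seg_value W e = wt \<Delta> e" if "e \<in> ?E" for e
    using compatible_iff[OF D(1) W(1)] W(2) that by blast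
  have nx: "next_vertex ?V p v" "next_vertex ?V v q"
    using next_vertex_cyc[of m i] next_vertex_cyc[of m "i + 1"] unfolding p_def v_def q_def by (simp_all add: add.assoc)
  have "p \<noteq> v" "q \<noteq> v" using nx unfolding next_vertex_def by auto
  have sides: "{v, p} \<in> boundary_edges m" "{v, q} \<in> boundary_edges m"
    unfolding boundary_edges_def p_def v_def q_def seg_def by (auto simp: insert_commute add.assoc intro: image_eqI)
  have pq: "{p, q} \<subseteq> N"
    using sides \<open>p \<noteq> v\<close> \<open>q \<noteq> v\<close> unfolding N_def neighbours_def edges_def by auto
  have v: "v \<in> ?V" unfolding v_def by (rule cyc_range)
  have star: "seg_value W {p, q} * (\<Prod>u \<in> N - {p, q}. seg_value W {v, u}) = star_sum ?E (seg_value W) v"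
    unfolding N_def by (rule star_formula[OF D(1) _ _ frieze_ptolemy[OF W(1)] nx]) simp_all
  \<comment> \<open>The only polygon sides at \<open>v\<close> lead to \<open>p\<close> and
    \<open>q\<close>; what remains are the diagonals, the denominator of
    \<open>Q_value\<close>.\<close>
  have "{e \<in> ?E. v \<in> e} - (\<lambda>u. {v, u}) ` {p, q} = diagonals_at \<Delta> v"
  proof -
    have "e = {v, p} \<or> e = {v, q}" if "e \<in> boundary_edges m" "v \<in> e" for e
    proof -
      obtain j where j: "e = {cyc m j, cyc m (j + 1)}"
        using \<open>e \<in> boundary_edges m\<close> unfolding boundary_edges_def seg_def by blast
      consider "v = cyc m j" | "v = cyc m (j + 1)"
        using \<open>v \<in> e\<close> j by blast
      then show ?thesis
      proof cases
        case 1
        then have "cyc m (j + 1) = q"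
          unfolding q_def v_def using cyc_succ[of m j] cyc_succ[of m "i + 1"] by (simp add: add.assoc)
        with 1 j show ?thesis by simp
      next
        case 2
        then have "cyc m j = p"
          unfolding p_def v_def using cyc_succ[of m j] cyc_succ[of m i] cyc_range[of m i] cyc_range[of m j]
          by (auto split: if_splits)
        with 2 j show ?thesis by (simp add: insert_commute)
      qed
    qed
    then show ?thesis
      using sides D(5) unfolding diagonals_at_def edges_def polygon_diagonals_eq by blast
  qed
  then have "(\<Prod>u \<in> N - {p, q}. seg_value W {v, u}) = (\<Prod>e \<in> diagonals_at \<Delta> v. seg_value W e)"
    using prod_neighbours[OF D(1), of "{p, q}" v "seg_value W"] pq unfolding N_def by simp
  also have "\<dots> = (\<Prod>e \<in> diagonals_at \<Delta> v. wt \<Delta> e)"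
    by (rule prod.cong) (auto simp: diagonals_at_def edges_def sv)
  finally have denom: "(\<Prod>u \<in> N - {p, q}. seg_value W {v, u}) = (\<Prod>e \<in> diagonals_at \<Delta> v. wt \<Delta> e)" .
  \<comment> \<open>Triangles at \<open>v\<close> correspond to their opposite sides:
    \<open>opp v\<close> and \<open>insert v\<close> are mutually inverse between the two index
    sets.\<close>
  have "star_sum ?E (seg_value W) v = (\<Sum>T \<in> {T \<in> triangles m \<Delta>. v \<in> T}.
      wt \<Delta> (opp v T) * (\<Prod>e \<in> edges_at m \<Delta> v - triangle_edges_at v T. wt \<Delta> e))"
    unfolding star_sum_def N_def[symmetric]
  proof (rule sum.reindex_bij_witness[where i = "opp v" and j = "insert v"])
    fix e assume "e \<in> {e \<in> ?E. e \<subseteq> N}"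
    then have e: "e \<in> ?E" "e \<subseteq> N" by auto
    then have ee: "e \<subseteq> ?V" "card e = 2"
      using D(1) unfolding full_triangulation_def pairs_def by auto
    then have fin: "finite e" by (metis card.infinite zero_neq_numeral)
    have ve: "v \<notin> e" using e(2) unfolding N_def neighbours_def by auto
    show opp: "opp v (insert v e) = e" unfolding opp_def using ve by simp
    have "f \<in> ?E" if "f \<subseteq> insert v e" "card f = 2" for f
    proof (cases "v \<in> f")
      case True
      then have "card (f - {v}) = 1" using that(2) by (simp add: card_Diff_singleton)
      then obtain u where "f - {v} = {u}" by (rule card_1_singletonE)
      then have "f = {v, u}" "u \<in> e" using True that(1) by blast+
      then show ?thesis using e(2) unfolding N_def neighbours_def by auto
    next
      case False
      then have "f \<subseteq> e" using that(1) by auto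
      then have "f = e" using that(2) ee(2) fin by (intro card_subset_eq) auto
      then show ?thesis using e(1) by simp
    qed
    moreover have "insert v e \<subseteq> ?V" "card (insert v e) = 3"
      using ee ve fin v by simp_all
    ultimately show "insert v e \<in> {T \<in> triangles m \<Delta>. v \<in> T}"
      unfolding triangles_def by blast
    have "triangle_edges_at v (insert v e) = (\<lambda>u. {v, u}) ` e"
    proof (intro equalityI subsetI)
      fix f assume "f \<in> triangle_edges_at v (insert v e)"
      then have f: "f \<subseteq> insert v e" "card f = 2" "v \<in> f"
        unfolding triangle_edges_at_def by auto
      then have "card (f - {v}) = 1" by (simp add: card_Diff_singleton)
      then obtain u where "f - {v} = {u}" by (rule card_1_singletonE)
      then have "f = {v, u}" "u \<in> e" using f by blast+
      then show "f \<in> (\<lambda>u. {v, u}) ` e" by blast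
    next
      fix f assume "f \<in> (\<lambda>u. {v, u}) ` e"
      then obtain u where "u \<in> e" "f = {v, u}" by blast
      then show "f \<in> triangle_edges_at v (insert v e)"
        unfolding triangle_edges_at_def using ve by (auto simp: card_insert_if)
    qed
    then have "(\<Prod>u \<in> N - e. seg_value W {v, u})
        = (\<Prod>f \<in> edges_at m \<Delta> v - triangle_edges_at v (insert v e). seg_value W f)"
      using prod_neighbours[OF D(1) e(2)[unfolded N_def], of "seg_value W"] unfolding N_def edges_at_def by simp
    also have "\<dots> = (\<Prod>f \<in> edges_at m \<Delta> v - triangle_edges_at v (insert v e). wt \<Delta> f)"
      by (rule prod.cong) (auto simp: edges_at_def sv)
    finally show "wt \<Delta> (opp v (insert v e)) * (\<Prod>f \<in> edges_at m \<Delta> v - triangle_edges_at v (insert v e). wt \<Delta> f)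
        = seg_value W e * (\<Prod>u \<in> N - e. seg_value W {v, u})"
      unfolding opp by (simp add: sv[OF e(1)])
  next
    fix T assume "T \<in> {T \<in> triangles m \<Delta>. v \<in> T}"
    then have T: "T \<subseteq> ?V" "card T = 3" "v \<in> T" and TE: "\<And>e. e \<subseteq> T \<Longrightarrow> card e = 2 \<Longrightarrow> e \<in> ?E"
      unfolding triangles_def by blast+
    show "insert v (opp v T) = T" unfolding opp_def using T(3) by blast
    have "opp v T \<in> ?E"
      using T(2,3) unfolding opp_def by (intro TE) (auto simp: card_Diff_singleton)
    moreover have "{v, u} \<in> ?E" if "u \<in> T" "u \<noteq> v" for u
      using T(3) that by (intro TE) auto
    then have "opp v T \<subseteq> N"
      unfolding N_def neighbours_def opp_def by auto
    ultimately show "opp v T \<in> {e \<in> ?E. e \<subseteq> N}" by blast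
  qed
  note num = this
  \<comment> \<open>\<open>unit_inverse\<close> is a definite description, so the denominator must
    be shown to be a unit before it can be evaluated.\<close>
  have "\<exists>r. (\<Prod>e \<in> A. wt \<Delta> e) * r = 1" if "finite A" "A \<subseteq> ?E" for A
    using that
  proof (induction A rule: finite_induct)
    case empty
    show ?case by simp
  next
    case (insert e A)
    have "A \<subseteq> ?E" "e \<in> ?E" using insert.prems by blast+
    obtain r where r: "(\<Prod>e \<in> A. wt \<Delta> e) * r = 1"
      using insert.IH[OF \<open>A \<subseteq> ?E\<close>] by blast
    obtain t where t: "wt \<Delta> e * t = 1"
      using D(7)[OF \<open>e \<in> ?E\<close>] by blast
    have "(\<Prod>e \<in> insert e A. wt \<Delta> e) * (t * r) = (wt \<Delta> e * t) * ((\<Prod>e \<in> A. wt \<Delta> e) * r)"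
      unfolding prod.insert[OF insert.hyps] by (simp only: ac_simps)
    also have "\<dots> = 1" unfolding r t by simp
    finally show ?case by blast
  qed
  moreover have "diagonals_at \<Delta> v \<subseteq> ?E" "finite ?E"
    using finite_full_triangulation[OF D(1)] unfolding diagonals_at_def edges_def by auto
  ultimately obtain r where r: "(\<Prod>e \<in> diagonals_at \<Delta> v. wt \<Delta> e) * r = 1"
    by (meson finite_subset)
  have "W (i, i + 2) = seg_value W {p, q}"
    unfolding p_def q_def by (rule frieze_entry[OF W(1)]) (simp add: strip_def)
  also have "\<dots> = seg_value W {p, q} * ((\<Prod>e \<in> diagonals_at \<Delta> v. wt \<Delta> e) * r)"
    unfolding r by simp
  also have "\<dots> = Q_value m \<Delta> v"
    unfolding Q_value_def unit_inverse_eqI[OF r] num[symmetric] star[symmetric] denom by (simp only: ac_simps)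
  finally show ?thesis unfolding v_def .
qed

section \<open>The two directions of the bijection\<close>

lemma compatible_frieze_ex1:
  assumes "\<Delta> \<in> weighted_triangulations m"
  shows "\<exists>!W. W \<in> normalized_positive_friezes m \<and> compatible m \<Delta> W"
proof -
  obtain W where W: "positive_frieze m W" "compatible m \<Delta> W"
    using compatible_frieze_exists[OF assms] by blast
  then have "W \<in> normalized_positive_friezes m \<and> compatible m \<Delta> W"
    using compatible_normalized[OF assms] unfolding normalized_positive_friezes_def by blast
  then show ?thesis
    using compatible_unique[OF assms] unfolding normalized_positive_friezes_def by blast
qed

text \<open>By maximality, a diagonal missing from the second triangulation crosses one of its
  edges, and then both would carry monomial entries of the same frieze.\<close>

lemma compatible_triangulation_subset:
  assumes \<Delta>: "\<Delta> \<in> weighted_triangulations m" "\<Delta>' \<in> weighted_triangulations m"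
    and W: "positive_frieze m W" "compatible m \<Delta> W" "compatible m \<Delta>' W"
  shows "fst \<Delta> \<subseteq> fst \<Delta>'"
proof
  note D = weighted_triangulationD[OF \<Delta>(1)]
  note D' = weighted_triangulationD[OF \<Delta>(2)]
  fix e assume e: "e \<in> fst \<Delta>"
  then have eE: "e \<in> edges m \<Delta>" and ep: "e \<in> pairs (polygon m)" "e \<notin> boundary_edges m"
    using D(5) unfolding edges_def polygon_diagonals_eq by auto
  show "e \<in> fst \<Delta>'"
  proof (rule ccontr)
    assume "e \<notin> fst \<Delta>'"
    then have "e \<notin> edges m \<Delta>'" using ep unfolding edges_def by blast
    then obtain f where f: "f \<in> edges m \<Delta>'" "crossing e f"
      using D'(1) ep(1) unfolding full_triangulation_def by blast
    have "f \<in> pairs (polygon m)"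
      using D'(1) f(1) unfolding full_triangulation_def by blast
    moreover have "seg_value W e = wt \<Delta> e" "seg_value W f = wt \<Delta>' f"
      using compatible_iff[OF D(1) W(1)] compatible_iff[OF D'(1) W(1)] W eE f(1) by blast+
    ultimately show False
      using crossing_not_monomials[OF W(1) ep(1) _ f(2)] D(8)[OF eE] D'(8)[OF f(1)] by simp
  qed
qed

lemma compatible_triangulation_unique:
  assumes \<Delta>: "\<Delta> \<in> weighted_triangulations m" "\<Delta>' \<in> weighted_triangulations m"
    and W: "positive_frieze m W" "compatible m \<Delta> W" "compatible m \<Delta>' W"
  shows "\<Delta> = \<Delta>'"
proof (rule prod_eqI)
  show fst: "fst \<Delta> = fst \<Delta>'"
    using compatible_triangulation_subset[OF \<Delta> W] compatible_triangulation_subset[OF \<Delta>(2,1) W(1,3,2)]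
    by blast
  then have E: "edges m \<Delta> = edges m \<Delta>'" unfolding edges_def by simp
  have "wt \<Delta> \<in> extensional (edges m \<Delta>)" "wt \<Delta>' \<in> extensional (edges m \<Delta>)"
    using \<Delta> E unfolding weighted_triangulations_def by auto
  moreover have "wt \<Delta> e = wt \<Delta>' e" if "e \<in> edges m \<Delta>" for e
  proof -
    have "seg_value W e = wt \<Delta> e" "seg_value W e = wt \<Delta>' e"
      using compatible_iff[OF weighted_triangulationD(1)[OF \<Delta>(1)] W(1)]
        compatible_iff[OF weighted_triangulationD(1)[OF \<Delta>(2)] W(1)] W that E by blast+
    then show ?thesis by simp
  qed
  ultimately show "wt \<Delta> = wt \<Delta>'" by (rule extensionalityI)
qed

text \<open>The monomial entries of a normalized frieze sit on pairwise noncrossing diagonals, and all \<open>m\<close>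
  of the variables \<open>x\<^sub>k\<close> occur among them; since \<open>m\<close> is the maximal number of such diagonals, they
  triangulate the polygon and each \<open>x\<^sub>k\<close> occurs once.\<close>

lemma frieze_has_triangulation:
  assumes "W \<in> normalized_positive_friezes m"
  shows "\<exists>\<Delta> \<in> weighted_triangulations m. compatible m \<Delta> W"
proof -
  have W: "positive_frieze m W" and norm: "normalized m W"
    using assms unfolding normalized_positive_friezes_def by auto
  define D where "D = {e \<in> polygon_diagonals m. laurent_monomial (seg_value W e)}"
  have D: "D \<subseteq> polygon_diagonals m" unfolding D_def by blast
  have nc: "noncrossing D"
    unfolding noncrossing_def D_def polygon_diagonals_eq using crossing_not_monomials[OF W] by blast
  have "seg_value W ` D = xvar ` {1..m}"
  proof (intro equalityI subsetI)
    fix x assume "x \<in> seg_value W ` D"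
    then obtain e where e: "e \<in> D" "x = seg_value W e" by blast
    then have "e \<in> pairs (polygon m)"
      using D unfolding polygon_diagonals_eq by blast
    then obtain a b where ab: "e = {a, b}" "a < b" "a \<in> polygon m" "b \<in> polygon m"
      by (elim pairsE)
    have "(a, b) \<in> interior_indices m"
      using interior_pair_iff[of a b m] ab e(1) D by auto
    moreover have "W (a, b) = x"
      using e(2) ab seg_value_pair[of a b W] by simp
    moreover have "laurent_monomial x" using e unfolding D_def by blast
    ultimately show "x \<in> xvar ` {1..m}"
      using norm unfolding normalized_def by blast
  next
    \<comment> \<open>The variable may occur anywhere in the strip; reducing the indices turns its
      position into a diagonal.\<close>
    fix x assume "x \<in> xvar ` {1..m}"
    then obtain k where k: "k \<in> {1..m}" "x = xvar k" by blast
    then obtain p where "p \<in> interior_indices m" "W p = x"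
      using norm unfolding normalized_def by blast
    then obtain i j where ij: "(i, j) \<in> interior_indices m" "W (i, j) = x"
      by (cases p) blast
    have "seg_value W {cyc m i, cyc m j} = x"
      using frieze_entry[OF W interior_seg_diagonal(2)[OF ij(1)]] ij(2) by simp
    moreover have "laurent_monomial x" unfolding k xvar_def by (rule laurent_monomial_var)
    ultimately show "x \<in> seg_value W ` D"
      using interior_seg_diagonal(1)[OF ij(1)] unfolding D_def by blast
  qed
  note image = this
  have finD: "finite D" and "card D \<le> m"
    using card_noncrossing_diagonals[OF D nc] .
  moreover have card_image: "card (seg_value W ` D) = m"
    unfolding image by (simp add: card_image inj_xvar)
  ultimately have card: "card D = m"
    using card_image_le[OF finD, of "seg_value W"] by simp
  then have "inj_on (seg_value W) D"
    using finD card_image by (intro eq_card_imp_inj_on) simp_all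
  then have bij: "bij_betw (seg_value W) D (xvar ` {1..m})"
    using image unfolding bij_betw_def by blast
  have tri: "triangulation m D"
    using max_noncrossing_triangulation[OF D nc] card by simp
  define \<Delta> where "\<Delta> = (D, restrict (seg_value W) (boundary_edges m \<union> D))"
  have E: "edges m \<Delta> = boundary_edges m \<union> D" and wt: "\<And>e. e \<in> edges m \<Delta> \<Longrightarrow> wt \<Delta> e = seg_value W e"
    unfolding \<Delta>_def edges_def by auto
  have "bij_betw (wt \<Delta>) D (xvar ` {1..m})"
    using bij by (subst bij_betw_cong[of D "wt \<Delta>" "seg_value W"]) (auto simp: wt E)
  moreover have "wt \<Delta> (seg m i (i + 1)) = yvar m i" for i
  proof -
    have "seg m i (i + 1) \<in> edges m \<Delta>" unfolding E boundary_edges_def by blast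
    then show ?thesis using wt seg_value_boundary[OF W] by simp
  qed
  moreover have "wt \<Delta> \<in> extensional (edges m \<Delta>)"
    unfolding E by (simp add: \<Delta>_def)
  ultimately have \<Delta>: "\<Delta> \<in> weighted_triangulations m"
    using tri unfolding weighted_triangulations_def by (simp add: \<Delta>_def)
  moreover have "compatible m \<Delta> W"
    using compatible_iff[OF weighted_triangulationD(1)[OF \<Delta>] W] wt by simp
  ultimately show ?thesis by blast
qed

theorem theorem1p2:
  fixes m :: nat
  shows "(\<forall>\<Delta> \<in> weighted_triangulations m.
            \<exists>!W. W \<in> normalized_positive_friezes m \<and> compatible m \<Delta> W) \<and>
         bij_betw (frieze_of m) (weighted_triangulations m) (normalized_positive_friezes m) \<and>
         (\<forall>\<Delta> \<in> weighted_triangulations m. \<forall>i.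
            frieze_of m \<Delta> (i, i + 2) = Q_value m \<Delta> (cyc m (i + 1)))"
proof (intro conjI ballI allI)
  have F: "frieze_of m \<Delta> \<in> normalized_positive_friezes m" "compatible m \<Delta> (frieze_of m \<Delta>)"
    if "\<Delta> \<in> weighted_triangulations m" for \<Delta>
    using theI'[OF compatible_frieze_ex1[OF that]] unfolding frieze_of_def by blast+
  have pos: "positive_frieze m W" if "W \<in> normalized_positive_friezes m" for W
    using that unfolding normalized_positive_friezes_def by blast
  show "\<exists>!W. W \<in> normalized_positive_friezes m \<and> compatible m \<Delta> W"
    if "\<Delta> \<in> weighted_triangulations m" for \<Delta>
    by (rule compatible_frieze_ex1[OF that])
  show "frieze_of m \<Delta> (i, i + 2) = Q_value m \<Delta> (cyc m (i + 1))"
    if "\<Delta> \<in> weighted_triangulations m" for \<Delta> i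
    by (rule frieze_quiddity[OF that pos[OF F(1)[OF that]] F(2)[OF that]])
  show "bij_betw (frieze_of m) (weighted_triangulations m) (normalized_positive_friezes m)"
  proof (rule bij_betw_imageI)
    show "inj_on (frieze_of m) (weighted_triangulations m)"
    proof (rule inj_onI)
      fix \<Delta> \<Delta>' assume \<Delta>: "\<Delta> \<in> weighted_triangulations m" "\<Delta>' \<in> weighted_triangulations m"
        and eq: "frieze_of m \<Delta> = frieze_of m \<Delta>'"
      show "\<Delta> = \<Delta>'"
        by (rule compatible_triangulation_unique[OF \<Delta> pos[OF F(1)[OF \<Delta>(1)]] F(2)[OF \<Delta>(1)]])
          (unfold eq, rule F(2)[OF \<Delta>(2)])
    qed
    have "W \<in> frieze_of m ` weighted_triangulations m" if W: "W \<in> normalized_positive_friezes m" for W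
    proof -
      obtain \<Delta> where \<Delta>: "\<Delta> \<in> weighted_triangulations m" "compatible m \<Delta> W"
        using frieze_has_triangulation[OF W] by blast
      \<comment> \<open>Surjectivity: both friezes are compatible with \<open>\<Delta>\<close>, and
        a compatible positive frieze is unique.\<close>
      have "W = frieze_of m \<Delta>"
        by (rule compatible_unique[OF \<Delta>(1) pos[OF W] \<Delta>(2) pos[OF F(1)[OF \<Delta>(1)]] F(2)[OF \<Delta>(1)]])
      with \<Delta>(1) show ?thesis by blast
    qed
    then show "frieze_of m ` weighted_triangulations m = normalized_positive_friezes m"
      using F(1) by blast
  qed
qed

end
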